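(* Let $m\ge1$, $n\ge4$, and let $\mathbf r=(r_1,\dots,r_n)$ be positive real numbers. For $1\le i,k\le n-3$ and $1\le j,\ell\le m+1$, $$\{\lambda_{ij},\lambda_{k\ell}\}=0$$ on the open subset of $\widetilde N_{\mathbf r}=\prod_{s}\mathcal O_{r_s}$ where $\lambda_{ij}$ is a simple eigenvalue of $A_i$ and $\lambda_{k\ell}$ is a simple eigenvalue of $A_k$.
   Context: For a unit vector $w\in\mathbb C^{m+1}$, $w\otimes w^*$ is the projection $v\mapsto(v,w)w$; $\mathcal O_r=\{r\,w\otimes w^*:\|w\|=1\}\subset\mathcal H_{m+1}$ (Hermitian $(m+1)\times(m+1)$ matrices). For $\mathbf e=(e_1,\dots,e_n)\in\widetilde N_{\mathbf r}$, $A_i=e_1+\cdots+e_{i+1}$ and $\lambda_{i1}\ge\cdots\ge\lambda_{i,m+1}$ are its eigenvalues, as functions of $\mathbf e$. The Poisson bracket on $\widetilde N_{\mathbf r}$ is the product of the Lie–Poisson (Kostant–Kirillov) brackets: $\{f,g\}(\mathbf e)=\sum_{s=1}^n\operatorname{Im}\operatorname{Tr}(e_s[\nabla_sf,\nabla_sg])$, where $\nabla_sf\in\mathfrak u(m+1)$ is the gradient of (any local smooth extension of) $f$ in the variable $e_s$, defined by $\operatorname{Im}\operatorname{Tr}(\nabla_s f\,Y)=\frac{d}{dt}|_{t=0}f(\dots,e_s+tY,\dots)$ for $Y\in\mathcal H_{m+1}$. *)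

theory Defs
  imports "HOL-Analysis.Analysis" "HOL-Computational_Algebra.Computational_Algebra"
begin

type_synonym 'd cmat = "complex^'d^'d"

definition cadj :: "'d::finite cmat \<Rightarrow> 'd cmat" where
  "cadj A = (\<chi> i j. cnj (A $ j $ i))"

definition hermitian :: "('d::finite cmat) set" where
  "hermitian = {A. cadj A = A}"

definition skew_hermitian :: "('d::finite cmat) set" where
  "skew_hermitian = {A. cadj A = - A}"

definition commutator :: "'d::finite cmat \<Rightarrow> 'd cmat \<Rightarrow> 'd cmat" where
  "commutator X Y = X ** Y - Y ** X"

definition charpoly :: "'d::finite cmat \<Rightarrow> complex poly" where
  "charpoly A = det (\<chi> i j. (if i = j then [:0, 1:] else 0) - [:A $ i $ j:])"

lemma poly_charpoly: "poly (charpoly A) z = det (mat z - A)"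
  unfolding charpoly_def det_def mat_def
  by (auto simp: poly_sum poly_prod intro!: sum.cong prod.cong)

text \<open>
  \<open>eigval j A\<close> is the \<open>j\<close>-th largest eigenvalue (\<open>j = 1, \<dots>, CARD('d)\<close>) of a Hermitian
  matrix, counted with multiplicity. The eigenvalues of a Hermitian matrix are real, so \<open>Re\<close>
  only changes the type.
\<close>
definition eigval :: "nat \<Rightarrow> 'd::finite cmat \<Rightarrow> real" where
  "eigval j A = rev (sorted_list_of_multiset (image_mset Re (proots (charpoly A)))) ! (j - 1)"

definition simple_eigenvalue :: "'d::finite cmat \<Rightarrow> real \<Rightarrow> bool" where
  "simple_eigenvalue A x \<longleftrightarrow> order (complex_of_real x) (charpoly A) = 1"

text \<open>
  An \<open>n\<close>-tuple \<open>(e\<^sub>1, \<dots>, e\<^sub>n)\<close> of matrices is a function on \<open>nat\<close> that is extensional on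
  \<open>{1..n}\<close>; the topology on the set of tuples is induced by the product topology on functions.
\<close>

definition outer :: "complex^'d::finite \<Rightarrow> 'd cmat" where
  "outer w = (\<chi> i j. w $ i * cnj (w $ j))"

lemma outer_vector_mult: "outer w *v v = (\<Sum>j\<in>UNIV. v $ j * cnj (w $ j)) *s w"
  by (simp add: vec_eq_iff outer_def matrix_vector_mult_def sum_distrib_left mult_ac)

definition orbit :: "real \<Rightarrow> ('d::finite cmat) set" where
  "orbit \<rho> = {\<rho> *\<^sub>R outer w | w. norm w = 1}"

definition orbit_product :: "nat \<Rightarrow> (nat \<Rightarrow> real) \<Rightarrow> (nat \<Rightarrow> 'd::finite cmat) set" where
  "orbit_product n r = (\<Pi>\<^sub>E s\<in>{1..n}. orbit (r s))"

definition herm_tuples :: "nat \<Rightarrow> (nat \<Rightarrow> 'd::finite cmat) set" where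
  "herm_tuples n = (\<Pi>\<^sub>E s\<in>{1..n}. hermitian)"

definition partial_sum :: "nat \<Rightarrow> (nat \<Rightarrow> 'd::finite cmat) \<Rightarrow> 'd cmat" where
  "partial_sum i e = (\<Sum>s=1..i+1. e s)"

definition lam :: "nat \<Rightarrow> nat \<Rightarrow> (nat \<Rightarrow> 'd::finite cmat) \<Rightarrow> real" where
  "lam i j e = eigval j (partial_sum i e)"

text \<open>
  \<open>C\<^sup>k\<close> functions on a set \<open>U\<close> that is open in \<open>herm_tuples n\<close>: \<open>F\<close> is \<open>C\<^sup>k\<^sup>+\<^sup>1\<close> iff its (Frechet)
  partial derivatives \<open>F' s\<close> in each of the variables \<open>e\<^sub>s\<close> exist and are of class \<open>C\<^sup>k\<close>. As
  the derivative is taken within the Hermitian matrices, \<open>F' s e Y\<close> is only meaningful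
  for Hermitian \<open>Y\<close>.
\<close>
primrec Ck_on :: "nat \<Rightarrow> nat \<Rightarrow> (nat \<Rightarrow> 'd::finite cmat) set \<Rightarrow> ((nat \<Rightarrow> 'd cmat) \<Rightarrow> real) \<Rightarrow> bool"
  where
  "Ck_on n 0 U F \<longleftrightarrow> continuous_on U F"
| "Ck_on n (Suc k) U F \<longleftrightarrow> continuous_on U F \<and>
    (\<exists>F'. (\<forall>s\<in>{1..n}. \<forall>e\<in>U.
             ((\<lambda>X. F (e(s := X))) has_derivative F' s e) (at (e s) within hermitian)) \<and>
          (\<forall>s\<in>{1..n}. \<forall>Y\<in>hermitian. Ck_on n k U (\<lambda>e. F' s e Y)))"

definition smooth_fun_on ::
  "nat \<Rightarrow> (nat \<Rightarrow> 'd::finite cmat) set \<Rightarrow> ((nat \<Rightarrow> 'd cmat) \<Rightarrow> real) \<Rightarrow> bool" where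
  "smooth_fun_on n U F \<longleftrightarrow> (\<forall>k. Ck_on n k U F)"

text \<open>\<open>F\<close> is a local smooth extension, near \<open>e\<close>, of the function \<open>f\<close> on \<open>orbit_product n r\<close>.\<close>
definition local_smooth_extension ::
  "nat \<Rightarrow> (nat \<Rightarrow> real) \<Rightarrow> ((nat \<Rightarrow> 'd::finite cmat) \<Rightarrow> real) \<Rightarrow> (nat \<Rightarrow> 'd cmat)
     \<Rightarrow> ((nat \<Rightarrow> 'd cmat) \<Rightarrow> real) \<Rightarrow> bool" where
  "local_smooth_extension n r f e F \<longleftrightarrow>
     (\<exists>U. openin (top_of_set (herm_tuples n)) U \<and> e \<in> U \<and> smooth_fun_on n U F \<and>
          (\<forall>x \<in> U \<inter> orbit_product n r. F x = f x))"

definition grad ::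
  "nat \<Rightarrow> ((nat \<Rightarrow> 'd::finite cmat) \<Rightarrow> real) \<Rightarrow> (nat \<Rightarrow> 'd cmat) \<Rightarrow> 'd cmat" where
  "grad s F e = (THE X. X \<in> skew_hermitian \<and>
     (\<forall>Y\<in>hermitian.
        ((\<lambda>t. F (e(s := e s + t *\<^sub>R Y))) has_real_derivative Im (trace (X ** Y))) (at 0)))"

definition lie_poisson ::
  "nat \<Rightarrow> ((nat \<Rightarrow> 'd::finite cmat) \<Rightarrow> real) \<Rightarrow> ((nat \<Rightarrow> 'd cmat) \<Rightarrow> real)
     \<Rightarrow> (nat \<Rightarrow> 'd cmat) \<Rightarrow> real" where
  "lie_poisson n F G e =
     (\<Sum>s=1..n. Im (trace (e s ** commutator (grad s F e) (grad s G e))))"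

text \<open>
  The bracket \<open>{f, g}(e)\<close> of functions on \<open>orbit_product n r\<close> is defined and equals \<open>b\<close>:
  \<open>f\<close> and \<open>g\<close> have local smooth extensions near \<open>e\<close>, and any choice of them gives the value \<open>b\<close>.
\<close>
definition has_poisson_bracket ::
  "nat \<Rightarrow> (nat \<Rightarrow> real) \<Rightarrow> ((nat \<Rightarrow> 'd::finite cmat) \<Rightarrow> real) \<Rightarrow> ((nat \<Rightarrow> 'd cmat) \<Rightarrow> real)
     \<Rightarrow> (nat \<Rightarrow> 'd cmat) \<Rightarrow> real \<Rightarrow> bool" where
  "has_poisson_bracket n r f g e b \<longleftrightarrow>
     (\<exists>F. local_smooth_extension n r f e F) \<and> (\<exists>G. local_smooth_extension n r g e G) \<and>
     (\<forall>F G. local_smooth_extension n r f e F \<longrightarrow> local_smooth_extension n r g e G \<longrightarrow>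
            lie_poisson n F G e = b)"

definition simple_locus ::
  "nat \<Rightarrow> (nat \<Rightarrow> real) \<Rightarrow> nat \<Rightarrow> nat \<Rightarrow> nat \<Rightarrow> nat \<Rightarrow> (nat \<Rightarrow> 'd::finite cmat) set" where
  "simple_locus n r i j k l = {e \<in> orbit_product n r.
     simple_eigenvalue (partial_sum i e) (lam i j e) \<and>
     simple_eigenvalue (partial_sum k e) (lam k l e)}"

end

theory Submission
  imports Defs
begin

text \<open>
  For skew-Hermitian \<open>Z\<close>, the derivative \<open>L\<close> of a simple eigenvalue of \<open>A\<close> vanishes on \<open>[Z, A]\<close>,
  because \<open>[Z, A]\<close> is tangent to the conjugation orbit of \<open>A\<close>. Let \<open>i \<le> k\<close>, and let \<open>X\<^sub>s\<close>, \<open>Y\<^sub>s\<close> be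
  the gradients of extensions of \<open>\<lambda>\<^sub>i\<^sub>j\<close> and \<open>\<lambda>\<^sub>k\<^sub>l\<close>. Then \<open>Im Tr (e\<^sub>s [X\<^sub>s, Y\<^sub>s]) = - Im Tr (Y\<^sub>s [X\<^sub>s, e\<^sub>s])\<close>
  is a derivative in the direction \<open>[X\<^sub>s, e\<^sub>s]\<close> tangent to the orbit of \<open>e\<^sub>s\<close>, so the extension may be
  replaced by \<open>\<lambda>\<^sub>k\<^sub>l\<close>, whose gradient \<open>H\<close> does not depend on \<open>s \<le> k + 1\<close>. Exchanging the roles of
  \<open>X\<^sub>s\<close> and \<open>H\<close> in the same way, the bracket becomes \<open>\<Sum>s\<le>i+1. L [H, e\<^sub>s] = L [H, A\<^sub>i] = 0\<close>.

  For the smoothness of a simple eigenvalue, its continuity comes from compactness (a limit of the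
  ordered roots is an ordered list of roots of the limit polynomial), its derivative from the
  characteristic equation, and the higher derivatives from bootstrapping the formula for the first.
\<close>

section \<open>Eigenvalues of Hermitian matrices\<close>

lemma degree_charpoly_entry_prod:
  fixes A :: "'d::finite cmat"
  assumes "p permutes UNIV" "p \<noteq> id"
  shows "degree (of_int (sign p) * (\<Prod>i\<in>UNIV. (\<chi> i j. (if i = j then [:0, 1:] else 0) - [:A $ i $ j:]) $ i $ p i))
    < CARD('d)"
proof -
  \<comment> \<open>The factor at a moved index is an off-diagonal entry, hence a constant
    polynomial; every other factor has degree at most one.\<close>
  obtain a where a: "p a \<noteq> a" using assms(2) by (metis eq_id_iff)
  let ?f = "\<lambda>i. (if i = p i then [:0, 1:] else 0) - [:A $ i $ p i:]"
  have "degree (of_int (sign p) * (\<Prod>i\<in>UNIV. ?f i)) \<le> degree (of_int (sign p) :: complex poly) + degree (\<Prod>i\<in>UNIV. ?f i)"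
    by (rule degree_mult_le)
  also have "\<dots> = degree (\<Prod>i\<in>UNIV. ?f i)" by simp
  also have "\<dots> \<le> (\<Sum>i\<in>UNIV. degree (?f i))"
    using degree_prod_sum_le[of UNIV ?f] by (simp add: o_def)
  also have "\<dots> < (\<Sum>i\<in>(UNIV::'d set). 1)"
    by (rule sum_strict_mono_ex1) (use a in \<open>auto intro!: exI[of _ a]\<close>)
  finally show ?thesis by simp
qed

text \<open>In the Leibniz expansion only the identity permutation reaches degree
  \<open>CARD('d)\<close>, and its term is a product of monic linear factors.\<close>

lemma charpoly_degree_lead_coeff:
  fixes A :: "'d::finite cmat"
  shows "degree (charpoly A) = CARD('d)" "lead_coeff (charpoly A) = 1"
proof -
  let ?M = "\<chi> i j. (if i = j then [:0, 1:] else 0) - [:A $ i $ j:]"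
  let ?t = "\<lambda>p. of_int (sign p) * (\<Prod>i\<in>UNIV. ?M $ i $ p i)"
  let ?P = "{p. p permutes (UNIV :: 'd set)}"
  let ?q = "\<Prod>i\<in>(UNIV::'d set). [:- (A $ i $ i), 1:]"
  have fin: "finite ?P" by (simp add: finite_permutations)
  have "charpoly A = ?t id + (\<Sum>p\<in>?P - {id}. ?t p)"
    unfolding charpoly_def det_def using fin by (subst sum.remove[of _ id]) (auto simp: permutes_id)
  also have "?t id = ?q" by (simp add: sign_id)
  finally have eq: "charpoly A = ?q + (\<Sum>p\<in>?P - {id}. ?t p)" .
  have "degree ?q = (\<Sum>i\<in>(UNIV::'d set). degree [:- (A $ i $ i), 1:])"
    by (rule degree_prod_eq_sum_degree) simp
  then have dq: "degree ?q = CARD('d)" by simp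
  have lq: "lead_coeff ?q = 1" by (simp add: lead_coeff_prod)
  have dr: "degree (\<Sum>p\<in>?P - {id}. ?t p) < CARD('d)"
    by (rule degree_sum_less) (use degree_charpoly_entry_prod[of _ A] in auto)
  have "coeff (\<Sum>p\<in>?P - {id}. ?t p) CARD('d) = 0" using dr by (rule coeff_eq_0)
  moreover have "coeff ?q CARD('d) = 1" using lq unfolding dq .
  ultimately have "coeff (charpoly A) CARD('d) = 1" unfolding eq coeff_add by simp
  moreover show "degree (charpoly A) = CARD('d)" unfolding eq using dq dr by (subst degree_add_eq_left) auto
  ultimately show "lead_coeff (charpoly A) = 1" by simp
qed

lemma charpoly_nonzero [simp]: "charpoly A \<noteq> 0"
  using charpoly_degree_lead_coeff(2)[of A] by fastforce

lemma charpoly_root_eigenvector: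
  fixes A :: "'d::finite cmat"
  assumes "poly (charpoly A) z = 0"
  obtains v where "v \<noteq> 0" "A *v v = z *s v"
proof -
  have "\<not> invertible (mat z - A)" using assms by (simp add: poly_charpoly invertible_det_nz)
  then obtain v where v: "v \<noteq> 0" "(mat z - A) *v v = 0"
    by (metis invertible_left_inverse matrix_left_invertible_ker)
  have "mat z *v v = z *s v"
    by (simp add: vec_eq_iff mat_def matrix_vector_mult_def if_distrib if_distribR cong: if_cong)
  with v show ?thesis
    using that[of v] by (auto simp: matrix_vector_mult_diff_rdistrib)
qed

lemma hermitian_nth: "A \<in> hermitian \<Longrightarrow> cnj (A $ i $ j) = A $ j $ i"
  by (auto simp: hermitian_def cadj_def vec_eq_iff)

text \<open>For an eigenvector \<open>v\<close>, the number \<open>?S\<close> is the quadratic form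
  of \<open>A\<close> at \<open>v\<close>. It equals its own conjugate because \<open>A\<close> is
  Hermitian, and it equals \<open>z\<close> times the positive real number
  \<open>?N\<close>.\<close>

lemma hermitian_charpoly_root_real:
  fixes A :: "'d::finite cmat"
  assumes "A \<in> hermitian" "poly (charpoly A) z = 0"
  shows "z \<in> \<real>"
proof -
  obtain v where v: "v \<noteq> 0" "A *v v = z *s v" using charpoly_root_eigenvector assms(2) by blast
  let ?N = "\<Sum>i\<in>UNIV. cnj (v $ i) * v $ i" and ?S = "\<Sum>i\<in>UNIV. cnj (v $ i) * (A *v v) $ i"
  have S1: "?S = z * ?N" using v by (simp add: sum_distrib_left mult_ac)
  have "cnj ?S = (\<Sum>i\<in>UNIV. \<Sum>j\<in>UNIV. v $ i * (A $ j $ i * cnj (v $ j)))"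
    by (simp add: matrix_vector_mult_def sum_distrib_left hermitian_nth[OF assms(1)])
  also have "\<dots> = ?S"
    by (subst sum.swap) (simp add: matrix_vector_mult_def sum_distrib_left mult_ac)
  finally have "cnj z * cnj ?N = z * ?N" using S1 by (metis complex_cnj_mult)
  also have "cnj ?N = ?N" by (simp add: mult.commute)
  finally have "(cnj z - z) * ?N = 0" by (simp add: algebra_simps)
  moreover have "?N \<noteq> 0"
  proof
    assume "?N = 0"
    then have "complex_of_real (\<Sum>i\<in>UNIV. (cmod (v $ i))\<^sup>2) = 0"
      by (simp add: complex_norm_square mult.commute del: of_real_power)
    then have "(\<Sum>i\<in>UNIV. (cmod (v $ i))\<^sup>2) = 0" using of_real_eq_0_iff by blast
    then have "\<forall>i. v $ i = 0" by (subst (asm) sum_nonneg_eq_0_iff) auto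
    then show False using v(1) by (simp add: vec_eq_iff)
  qed
  ultimately show ?thesis by (simp add: Reals_cnj_iff)
qed

text \<open>Reading the eigenvalue equation at a coordinate of the eigenvector of largest modulus
  bounds \<open>z\<close> by one row sum. The cruder sum over all entries is continuous in
  \<open>A\<close> and so stays bounded along convergent sequences, as the compactness argument
  requires.\<close>

lemma charpoly_root_bound:
  fixes A :: "'d::finite cmat"
  assumes "poly (charpoly A) z = 0"
  shows "cmod z \<le> (\<Sum>i\<in>UNIV. \<Sum>j\<in>UNIV. cmod (A $ i $ j))"
proof -
  obtain v where v: "v \<noteq> 0" "A *v v = z *s v" using charpoly_root_eigenvector assms by blast
  have "Max (range (\<lambda>b. cmod (v $ b))) \<in> range (\<lambda>b. cmod (v $ b))"
    by (rule Max_in) auto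
  then obtain a where max: "cmod (v $ a) = Max (range (\<lambda>b. cmod (v $ b)))" by force
  have a: "cmod (v $ b) \<le> cmod (v $ a)" for b
    unfolding max by (rule Max_ge) auto
  have "cmod (v $ a) > 0"
  proof (rule ccontr)
    assume "\<not> cmod (v $ a) > 0"
    then have "cmod (v $ b) \<le> 0" for b using a[of b] by linarith
    then show False using v(1) by (simp add: vec_eq_iff)
  qed
  have "cmod z * cmod (v $ a) = cmod ((A *v v) $ a)" by (simp add: v norm_mult)
  also have "\<dots> \<le> (\<Sum>j\<in>UNIV. cmod (A $ a $ j) * cmod (v $ j))"
    unfolding matrix_vector_mult_def by (auto simp flip: norm_mult intro: norm_sum)
  also have "\<dots> \<le> (\<Sum>j\<in>UNIV. cmod (A $ a $ j) * cmod (v $ a))"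
    by (intro sum_mono mult_left_mono a) auto
  also have "\<dots> = (\<Sum>j\<in>UNIV. cmod (A $ a $ j)) * cmod (v $ a)" by (simp add: sum_distrib_right)
  finally have "cmod z \<le> (\<Sum>j\<in>UNIV. cmod (A $ a $ j))" using \<open>cmod (v $ a) > 0\<close> by simp
  also have "\<dots> \<le> (\<Sum>i\<in>UNIV. \<Sum>j\<in>UNIV. cmod (A $ i $ j))"
    by (rule member_le_sum) (auto intro: sum_nonneg)
  finally show ?thesis .
qed

lemma length_eigenvalue_list:
  fixes A :: "'d::finite cmat"
  shows "length (rev (sorted_list_of_multiset (image_mset Re (proots (charpoly A))))) = CARD('d)"
  by (metis charpoly_degree_lead_coeff(1) length_rev mset_sorted_list_of_multiset size_image_mset
      size_mset size_proots_complex)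

lemma eigval_antimono:
  fixes A :: "'d::finite cmat"
  assumes "a \<le> b" "b < CARD('d)"
  shows "eigval (Suc b) A \<le> eigval (Suc a) A"
proof -
  let ?xs = "sorted_list_of_multiset (image_mset Re (proots (charpoly A)))"
  have "sorted ?xs" by simp
  then show ?thesis using assms length_eigenvalue_list[of A]
    by (auto simp: eigval_def sorted_rev_nth_mono simp del: length_rev)
qed

text \<open>The polynomial splits over the complex numbers into its roots with multiplicity. These
  are real, so passing to \<open>Re\<close> and sorting loses nothing.\<close>

lemma charpoly_hermitian_factors:
  fixes A :: "'d::finite cmat"
  assumes "A \<in> hermitian"
  shows "charpoly A = (\<Prod>j<CARD('d). [:- of_real (eigval (Suc j) A), 1:])"
proof -
  let ?M = "proots (charpoly A)"
  let ?xs = "rev (sorted_list_of_multiset (image_mset Re ?M))"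
  have "charpoly A = (\<Prod>z|poly (charpoly A) z = 0. [:-z, 1:] ^ order z (charpoly A))"
    by (rule complex_poly_decompose[of "charpoly A", unfolded charpoly_degree_lead_coeff(2) smult_1_left, symmetric])
  also have "\<dots> = (\<Prod>z\<in>set_mset ?M. [:-z, 1:] ^ count ?M z)"
    by (rule prod.cong) simp_all
  also have "\<dots> = prod_mset (image_mset (\<lambda>z. [:-z, 1:]) ?M)"
    by (rule image_prod_mset_multiplicity[symmetric])
  also have "image_mset (\<lambda>z. [:-z, 1:]) ?M = image_mset (\<lambda>z. [:- of_real (Re z), 1:]) ?M"
  proof (rule image_mset_cong)
    fix z assume "z \<in># ?M"
    then have "z \<in> \<real>" using hermitian_charpoly_root_real[OF assms] by simp
    then show "[:-z, 1:] = [:- of_real (Re z), 1:]" by (simp add: of_real_Re)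
  qed
  also have "\<dots> = image_mset (\<lambda>x. [:- of_real x, 1:]) (image_mset Re ?M)"
    by (simp add: multiset.map_comp o_def)
  also have "image_mset Re ?M = mset ?xs" by simp
  also have "prod_mset (image_mset (\<lambda>x. [:- complex_of_real x, 1:]) (mset ?xs)) = prod_list (map (\<lambda>x. [:- of_real x, 1:]) ?xs)"
    by (simp only: mset_map[symmetric] prod_mset_prod_list)
  also have "\<dots> = (\<Prod>j<length ?xs. [:- of_real (?xs ! j), 1:])"
    unfolding prod.list_conv_set_nth length_map lessThan_atLeast0 by (rule prod.cong) simp_all
  finally show ?thesis unfolding length_eigenvalue_list by (simp add: eigval_def)
qed

section \<open>Continuity of ordered roots and eigenvalues\<close>

lemma decreasing_roots_unique:
  fixes b c :: "nat \<Rightarrow> real"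
  assumes "(\<Prod>j<d. [:- complex_of_real (b j), 1:]) = (\<Prod>j<d. [:- of_real (c j), 1:])"
    and b: "\<And>i j. i \<le> j \<Longrightarrow> j < d \<Longrightarrow> b j \<le> b i" and c: "\<And>i j. i \<le> j \<Longrightarrow> j < d \<Longrightarrow> c j \<le> c i"
    and "j < d"
  shows "b j = c j"
proof -
  have roots: "proots (\<Prod>j<d. [:- complex_of_real (f j), 1:]) = image_mset of_real (mset (rev (map f [0..<d])))"
    for f :: "nat \<Rightarrow> real"
  proof -
    have "proots (\<Prod>j<d. [:- complex_of_real (f j), 1:]) = (\<Sum>j<d. {# of_real (f j) #})"
      by (subst proots_prod) auto
    also have "\<dots> = image_mset of_real (mset (rev (map f [0..<d])))"
      by (induction d) auto
    finally show ?thesis .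
  qed
  have sorted: "sorted (rev (map f [0..<d]))" if "\<And>i j. i \<le> j \<Longrightarrow> j < d \<Longrightarrow> f j \<le> f i" for f :: "nat \<Rightarrow> real"
    unfolding sorted_rev_iff_nth_mono using that by simp
  \<comment> \<open>\<open>proots\<close> recovers the multiset of values from the product; a
    decreasing sequence is then recovered from its multiset by sorting.\<close>
  have "image_mset Re (image_mset of_real (mset (rev (map b [0..<d]))))
      = image_mset Re (image_mset of_real (mset (rev (map c [0..<d]))))"
    using arg_cong[OF assms(1), of proots] by (simp only: roots)
  then have "mset (rev (map b [0..<d])) = mset (rev (map c [0..<d]))"
    by (simp only: multiset.map_comp o_def Re_complex_of_real multiset.map_ident)
  then have "rev (map b [0..<d]) = rev (map c [0..<d])"
    using sorted[of b, OF b] sorted[of c, OF c] by (metis properties_for_sort)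
  then show ?thesis using \<open>j < d\<close> by auto
qed

text \<open>Bolzano-Weierstrass one coordinate at a time, each time passing to a further
  subsequence.\<close>

lemma bounded_finitely_many_convergent_subsequence:
  fixes a :: "nat \<Rightarrow> nat \<Rightarrow> real"
  assumes "\<And>j. j < d \<Longrightarrow> bounded (range (\<lambda>n. a n j))"
  shows "\<exists>\<rho>. strict_mono \<rho> \<and> (\<forall>j<d. convergent (\<lambda>n. a (\<rho> n) j))"
  using assms
proof (induction d)
  case 0
  show ?case using strict_mono_id by auto
next
  case (Suc d)
  then obtain \<rho> where \<rho>: "strict_mono \<rho>" "\<And>j. j < d \<Longrightarrow> convergent (\<lambda>n. a (\<rho> n) j)" by auto
  have "bounded (range (\<lambda>n. a (\<rho> n) d))"
    by (rule bounded_subset[OF Suc.prems[of d]]) auto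
  then obtain l \<sigma> where \<sigma>: "strict_mono \<sigma>" "((\<lambda>n. a (\<rho> n) d) \<circ> \<sigma>) \<longlonglongrightarrow> l"
    using bounded_imp_convergent_subsequence by blast
  have "convergent (\<lambda>n. a ((\<rho> \<circ> \<sigma>) n) j)" if "j < Suc d" for j
    using that \<sigma> convergent_subseq_convergent[OF \<rho>(2)[of j] \<sigma>(1)]
    by (cases "j = d") (auto simp: o_def intro: convergentI)
  then show ?case using strict_mono_o[OF \<rho>(1) \<sigma>(1)] by blast
qed

text \<open>If the \<open>j\<close>-th root stayed \<open>\<epsilon>\<close> away from
  \<open>b j\<close> along a subsequence, a further subsequence of all roots would converge to a
  decreasing list \<open>c\<close>. Both lists have the limit polynomial, so
  \<open>c j = b j\<close>, a contradiction.\<close>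

lemma decreasing_roots_tendsto:
  fixes a :: "nat \<Rightarrow> nat \<Rightarrow> real" and b :: "nat \<Rightarrow> real"
  assumes a: "\<And>n i j. i \<le> j \<Longrightarrow> j < d \<Longrightarrow> a n j \<le> a n i" and b: "\<And>i j. i \<le> j \<Longrightarrow> j < d \<Longrightarrow> b j \<le> b i"
    and bdd: "\<And>n j. j < d \<Longrightarrow> \<bar>a n j\<bar> \<le> C"
    and lim: "\<And>z. (\<lambda>n. \<Prod>j<d. z - complex_of_real (a n j)) \<longlonglongrightarrow> (\<Prod>j<d. z - of_real (b j))"
    and "j < d"
  shows "(\<lambda>n. a n j) \<longlonglongrightarrow> b j"
proof (rule ccontr)
  assume "\<not> ?thesis"
  then obtain \<epsilon> where \<epsilon>: "\<epsilon> > 0" "\<exists>\<^sub>F n in sequentially. \<epsilon> \<le> dist (a n j) (b j)"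
    by (auto simp: tendsto_iff frequently_def not_le)
  then have "infinite {n. \<epsilon> \<le> dist (a n j) (b j)}"
    unfolding cofinite_eq_sequentially[symmetric] frequently_cofinite by blast
  then obtain \<sigma> :: "nat \<Rightarrow> nat" where \<sigma>: "strict_mono \<sigma>" "\<And>n. \<epsilon> \<le> dist (a (\<sigma> n) j) (b j)"
    using infinite_enumerate by blast
  have "\<exists>\<rho>. strict_mono \<rho> \<and> (\<forall>j<d. convergent (\<lambda>n. a (\<sigma> (\<rho> n)) j))"
  proof (rule bounded_finitely_many_convergent_subsequence)
    fix j assume "j < d"
    then show "bounded (range (\<lambda>n. a (\<sigma> n) j))" unfolding bounded_iff using bdd by auto
  qed
  then obtain \<rho> where \<rho>: "strict_mono \<rho>" "\<And>j. j < d \<Longrightarrow> convergent (\<lambda>n. a (\<sigma> (\<rho> n)) j)" by auto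
  define c where "c j = lim (\<lambda>n. a (\<sigma> (\<rho> n)) j)" for j
  have c: "(\<lambda>n. a (\<sigma> (\<rho> n)) j) \<longlonglongrightarrow> c j" if "j < d" for j
    using \<rho>(2)[OF that] by (simp add: c_def convergent_LIMSEQ_iff)
  have mono: "c k \<le> c i" if "i \<le> k" "k < d" for i k
  proof (rule LIMSEQ_le[OF c c])
    show "\<exists>N. \<forall>n\<ge>N. a (\<sigma> (\<rho> n)) k \<le> a (\<sigma> (\<rho> n)) i" using a[OF that] by blast
  qed (use that in auto)
  have "strict_mono (\<sigma> \<circ> \<rho>)" using \<rho> \<sigma> by (simp add: strict_mono_o)
  have poly_eq: "poly (\<Prod>j<d. [:- complex_of_real (b j), 1:]) z = poly (\<Prod>j<d. [:- of_real (c j), 1:]) z" for z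
  proof -
    have "(\<lambda>n. \<Prod>j<d. z - complex_of_real (a (\<sigma> (\<rho> n)) j)) \<longlonglongrightarrow> (\<Prod>j<d. z - of_real (c j))"
      by (intro tendsto_intros c) auto
    moreover have "(\<lambda>n. \<Prod>j<d. z - complex_of_real (a (\<sigma> (\<rho> n)) j)) \<longlonglongrightarrow> (\<Prod>j<d. z - of_real (b j))"
      using LIMSEQ_subseq_LIMSEQ[OF lim \<open>strict_mono (\<sigma> \<circ> \<rho>)\<close>] by (simp add: o_def)
    ultimately show ?thesis using LIMSEQ_unique by (auto simp: poly_prod)
  qed
  have "b j = c j"
  proof (rule decreasing_roots_unique[OF _ b mono \<open>j < d\<close>])
    show "(\<Prod>j<d. [:- complex_of_real (b j), 1:]) = (\<Prod>j<d. [:- of_real (c j), 1:])"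
      unfolding poly_eq_poly_eq_iff[symmetric] using poly_eq by blast
  qed
  then have "(\<lambda>n. a (\<sigma> (\<rho> n)) j) \<longlonglongrightarrow> b j" using c[OF \<open>j < d\<close>] by simp
  then have "(\<lambda>n. dist (a (\<sigma> (\<rho> n)) j) (b j)) \<longlonglongrightarrow> 0"
    by (rule tendsto_dist_iff[THEN iffD1])
  then have "\<epsilon> \<le> 0" using \<sigma>(2) by (intro LIMSEQ_le_const) auto
  then show False using \<epsilon> by simp
qed

lemma continuous_on_eigval:
  assumes "j < CARD('d::finite)"
  shows "continuous_on hermitian (eigval (Suc j) :: 'd cmat \<Rightarrow> real)"
proof -
  have "(\<lambda>n. eigval (Suc j) (A n)) \<longlonglongrightarrow> eigval (Suc j) B"
    if A: "\<And>n. A n \<in> hermitian" and B: "B \<in> hermitian" and lim: "A \<longlonglongrightarrow> B" for A and B :: "'d cmat"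
  proof -
    let ?g = "\<lambda>A::'d cmat. \<Sum>i\<in>UNIV. \<Sum>j\<in>UNIV. cmod (A $ i $ j)"
    have "(\<lambda>n. ?g (A n)) \<longlonglongrightarrow> ?g B" by (intro tendsto_intros lim)
    then have "Bseq (\<lambda>n. ?g (A n))" using convergent_imp_Bseq convergentI by blast
    then obtain C where C: "\<And>n. \<bar>?g (A n)\<bar> \<le> C" unfolding Bseq_def real_norm_def by blast
    have root: "poly (charpoly (A n)) (of_real (eigval (Suc j) (A n))) = 0" if "j < CARD('d)" for n j
      unfolding charpoly_hermitian_factors[OF A] using that by (auto simp: poly_prod)
    have C': "\<bar>eigval (Suc j) (A n)\<bar> \<le> C" if "j < CARD('d)" for n j
      using charpoly_root_bound[OF root[OF that, of n]] C[of n] by simp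
    have lim': "(\<lambda>n. \<Prod>j<CARD('d). z - complex_of_real (eigval (Suc j) (A n))) \<longlonglongrightarrow> (\<Prod>j<CARD('d). z - of_real (eigval (Suc j) B))" for z
    proof -
      \<comment> \<open>The product over the eigenvalues is a determinant, hence a polynomial in the
        entries, and converges with the matrices.\<close>
      have 1: "(\<Prod>j<CARD('d). z - complex_of_real (eigval (Suc j) X)) = det (mat z - X)" if "X \<in> hermitian" for X :: "'d cmat"
        by (subst poly_charpoly[symmetric], subst charpoly_hermitian_factors[OF that]) (simp add: poly_prod)
      show ?thesis unfolding 1[OF A] 1[OF B] det_def by (intro tendsto_intros lim)
    qed
    show ?thesis
      by (rule decreasing_roots_tendsto[where d = "CARD('d)" and a = "\<lambda>n j. eigval (Suc j) (A n)"
          and b = "\<lambda>j. eigval (Suc j) B", OF eigval_antimono eigval_antimono C' lim' assms])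
  qed
  then show ?thesis unfolding continuous_on_sequentially by (auto simp: o_def)
qed

section \<open>Smoothness of simple eigenvalues\<close>

text \<open>A counterpart of \<open>Ck_on\<close> for one variable and complex values, so that
  coefficients of \<open>charpoly\<close> fit in. Points range over \<open>V\<close>, while
  derivatives are taken within \<open>S\<close> and tested only in directions from \<open>S\<close>;
  in the applications \<open>S\<close> is \<open>hermitian\<close>.\<close>

primrec Ck_within :: "nat \<Rightarrow> 'a::real_normed_vector set \<Rightarrow> 'a set \<Rightarrow> ('a \<Rightarrow> complex) \<Rightarrow> bool" where
  "Ck_within 0 S V f \<longleftrightarrow> continuous_on V f"
| "Ck_within (Suc k) S V f \<longleftrightarrow> continuous_on V f \<and>
    (\<exists>f'. (\<forall>x\<in>V. (f has_derivative f' x) (at x within S)) \<and> (\<forall>h\<in>S. Ck_within k S V (\<lambda>x. f' x h)))"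

lemma Ck_within_imp_continuous_on: "Ck_within k S V f \<Longrightarrow> continuous_on V f"
  by (cases k) auto

lemma Ck_within_SucD: "Ck_within (Suc k) S V f \<Longrightarrow> Ck_within k S V f"
proof (induction k arbitrary: f)
  case (Suc k)
  then obtain f' where "\<forall>x\<in>V. (f has_derivative f' x) (at x within S)"
    "\<forall>h\<in>S. Ck_within (Suc k) S V (\<lambda>x. f' x h)" by auto
  with Suc show ?case by (auto intro!: exI[of _ f'])
qed auto

lemma Ck_within_const: "Ck_within k S V (\<lambda>_. c)"
proof (induction k arbitrary: c)
  case (Suc k)
  then show ?case by (auto intro!: exI[of _ "\<lambda>_ _. 0"])
qed auto

lemma Ck_within_bounded_linear:
  assumes "bounded_linear f"
  shows "Ck_within k S V f"
  using assms
  by (cases k) (auto intro!: exI[of _ "\<lambda>_. f"] Ck_within_const bounded_linear_imp_has_derivative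
      linear_continuous_on)

lemma Ck_within_add:
  "Ck_within k S V f \<Longrightarrow> Ck_within k S V g \<Longrightarrow> Ck_within k S V (\<lambda>x. f x + g x)"
proof (induction k arbitrary: f g)
  case 0
  then show ?case by (auto intro: continuous_on_add)
next
  case (Suc k)
  from Suc.prems obtain f' g' where
    "\<forall>x\<in>V. (f has_derivative f' x) (at x within S)" "\<forall>h\<in>S. Ck_within k S V (\<lambda>x. f' x h)"
    "\<forall>x\<in>V. (g has_derivative g' x) (at x within S)" "\<forall>h\<in>S. Ck_within k S V (\<lambda>x. g' x h)"
    by auto
  with Suc show ?case
    by (auto intro!: exI[of _ "\<lambda>x h. f' x h + g' x h"] continuous_on_add has_derivative_add)
qed

lemma Ck_within_mult:
  "Ck_within k S V f \<Longrightarrow> Ck_within k S V g \<Longrightarrow> Ck_within k S V (\<lambda>x. f x * g x)"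
proof (induction k arbitrary: f g)
  case 0
  then show ?case by (auto intro: continuous_on_mult)
next
  case (Suc k)
  from Suc.prems obtain f' g' where
    "\<forall>x\<in>V. (f has_derivative f' x) (at x within S)" "\<forall>h\<in>S. Ck_within k S V (\<lambda>x. f' x h)"
    "\<forall>x\<in>V. (g has_derivative g' x) (at x within S)" "\<forall>h\<in>S. Ck_within k S V (\<lambda>x. g' x h)"
    by auto
  moreover have "Ck_within k S V f" "Ck_within k S V g" using Suc.prems Ck_within_SucD by blast+
  ultimately show ?case using Suc
    by (auto intro!: exI[of _ "\<lambda>x h. f x * g' x h + f' x h * g x"] continuous_on_mult
        has_derivative_mult Ck_within_add)
qed

lemma Ck_within_minus: "Ck_within k S V f \<Longrightarrow> Ck_within k S V (\<lambda>x. - f x)"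
  using Ck_within_mult[OF Ck_within_const[of k S V "-1"]] by simp

lemma Ck_within_inverse:
  "Ck_within k S V f \<Longrightarrow> \<forall>x\<in>V. f x \<noteq> 0 \<Longrightarrow> Ck_within k S V (\<lambda>x. inverse (f x))"
proof (induction k arbitrary: f)
  case 0
  then show ?case by (auto intro: continuous_on_inverse)
next
  case (Suc k)
  from Suc.prems obtain f' where
    "\<forall>x\<in>V. (f has_derivative f' x) (at x within S)" "\<forall>h\<in>S. Ck_within k S V (\<lambda>x. f' x h)"
    by auto
  moreover have "Ck_within k S V (\<lambda>x. inverse (f x))" using Suc Ck_within_SucD by blast
  ultimately show ?case using Suc.prems
    by (auto intro!: exI[of _ "\<lambda>x h. - (inverse (f x) * f' x h * inverse (f x))"] continuous_on_inverse
        has_derivative_inverse Ck_within_minus Ck_within_mult)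
qed

lemma Ck_within_sum:
  "(\<And>i. i \<in> I \<Longrightarrow> Ck_within k S V (f i)) \<Longrightarrow> Ck_within k S V (\<lambda>x. \<Sum>i\<in>I. f i x)"
  by (induction I rule: infinite_finite_induct) (auto intro: Ck_within_const Ck_within_add)

lemma Ck_within_power: "Ck_within k S V f \<Longrightarrow> Ck_within k S V (\<lambda>x. f x ^ n)"
  by (induction n) (auto intro: Ck_within_const Ck_within_mult)

text \<open>Regularity of a polynomial-valued map is expressed coefficient by coefficient; the
  Cauchy product formula makes this stable under products.\<close>

lemma Ck_within_coeff_prod:
  assumes "finite I" "\<And>i n. i \<in> I \<Longrightarrow> Ck_within k S V (\<lambda>x. coeff (p i x) n)"
  shows "Ck_within k S V (\<lambda>x. coeff (\<Prod>i\<in>I. p i x) n)"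
  using assms
proof (induction I arbitrary: n rule: finite_induct)
  case empty
  show ?case by (simp add: Ck_within_const)
next
  case (insert i I)
  then show ?case by (auto simp: coeff_mult intro!: Ck_within_sum Ck_within_mult)
qed

lemma Ck_within_coeff_charpoly:
  fixes V :: "'d::finite cmat set"
  shows "Ck_within k S V (\<lambda>A. coeff (charpoly A) n)"
proof -
  have nth: "Ck_within k S V (\<lambda>A. A $ i $ j)" for i j :: 'd
    by (intro Ck_within_bounded_linear bounded_linear_vec_nth[THEN bounded_linear_compose]
        bounded_linear_vec_nth)
  have "Ck_within k S V (\<lambda>A. coeff ((if i = j then [:0, 1:] else 0) - [:A $ i $ j:]) n)" for i j n
  proof (cases n)
    case 0
    have "Ck_within k S V (\<lambda>A. - (A $ i $ j))" by (intro Ck_within_minus nth)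
    then show ?thesis by (cases "i = j") (simp_all add: 0)
  qed (simp add: Ck_within_const)
  note entry = this
  have *: "coeff (of_int (sign p) * q) n = of_int (sign p) * coeff q n" for p :: "'d \<Rightarrow> 'd" and q :: "complex poly"
    by (simp add: of_int_poly)
  show ?thesis
    unfolding charpoly_def det_def coeff_sum * vec_lambda_beta
    by (intro Ck_within_sum Ck_within_mult Ck_within_const Ck_within_coeff_prod finite entry)
qed

text \<open>Since \<open>N x = 0\<close>, the product rule needs only continuity of \<open>g\<close>
  at \<open>x\<close>. This is essential below, where \<open>g\<close> involves a root not yet known
  to be differentiable.\<close>

lemma has_derivative_vanishing_times_tendsto:
  fixes N g :: "'a::real_normed_vector \<Rightarrow> complex"
  assumes N: "(N has_derivative N') (at x within S)" and "N x = 0" and g: "(g \<longlongrightarrow> c) (at x within S)"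
    and "g x = c"
  shows "((\<lambda>y. N y * g y) has_derivative (\<lambda>h. N' h * c)) (at x within S)"
proof -
  interpret N': bounded_linear N' using N by (rule has_derivative_bounded_linear)
  obtain K where K: "\<And>h. norm (N' h) \<le> norm h * K" using N'.bounded by blast
  have "((\<lambda>y. ((N y - N' (y - x)) /\<^sub>R norm (y - x)) * g y) \<longlongrightarrow> 0 * c) (at x within S)"
    using N \<open>N x = 0\<close> g by (intro tendsto_mult) (auto simp: has_derivative_at_within)
  \<comment> \<open>The normalized linear part is bounded by \<open>K\<close>, and the other factor
    tends to zero.\<close>
  moreover have "((\<lambda>y. (N' (y - x) /\<^sub>R norm (y - x)) * (g y - c)) \<longlongrightarrow> 0) (at x within S)"
  proof (rule Lim_null_comparison)
    show "((\<lambda>y. K * norm (g y - c)) \<longlongrightarrow> 0) (at x within S)"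
      by (intro tendsto_mult_right_zero tendsto_norm_zero LIM_zero g)
    show "\<forall>\<^sub>F y in at x within S. norm ((N' (y - x) /\<^sub>R norm (y - x)) * (g y - c)) \<le> K * norm (g y - c)"
      unfolding eventually_at_filter
    proof (intro always_eventually allI impI)
      fix y assume "y \<noteq> x"
      then have "norm (N' (y - x) /\<^sub>R norm (y - x)) \<le> K" using K[of "y - x"] by (simp add: field_simps)
      then show "norm ((N' (y - x) /\<^sub>R norm (y - x)) * (g y - c)) \<le> K * norm (g y - c)"
        unfolding norm_mult by (rule mult_right_mono) simp
    qed
  qed
  ultimately have "((\<lambda>y. ((N y - N' (y - x)) /\<^sub>R norm (y - x)) * g y + (N' (y - x) /\<^sub>R norm (y - x)) * (g y - c))
      \<longlongrightarrow> 0 * c + 0) (at x within S)" by (rule tendsto_add)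
  moreover have "((N y - N' (y - x)) /\<^sub>R norm (y - x)) * g y + (N' (y - x) /\<^sub>R norm (y - x)) * (g y - c)
      = (N y * g y - N x * g x - N' (y - x) * c) /\<^sub>R norm (y - x)" for y
    by (simp add: \<open>N x = 0\<close> scaleR_conv_of_real algebra_simps)
  ultimately show ?thesis unfolding has_derivative_at_within
    by (auto intro: N'.bounded_linear_axioms bounded_linear_mult_const)
qed

text \<open>
  With \<open>N y = (\<Sum>k\<le>d. c k y * \<phi> x ^ k)\<close> the equation factors as \<open>(\<phi> y - \<phi> x) * Q y = - N y\<close>, where
  \<open>Q y \<longlongrightarrow> D\<close> by continuity of \<open>\<phi>\<close>; no implicit function theorem is needed.
\<close>
lemma has_derivative_polynomial_root:
  fixes c :: "nat \<Rightarrow> 'a::real_normed_vector \<Rightarrow> complex"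
  assumes c: "\<And>k. (c k has_derivative c' k) (at x within S)" and "x \<in> S"
    and \<phi>: "(\<phi> \<longlongrightarrow> \<phi> x) (at x within S)"
    and root: "\<And>y. y \<in> S \<Longrightarrow> (\<Sum>k\<le>d. c k y * \<phi> y ^ k) = 0"
    and D: "D = (\<Sum>k\<le>d. c k x * (of_nat k * \<phi> x ^ (k - 1)))" "D \<noteq> 0"
  shows "(\<phi> has_derivative (\<lambda>h. - (\<Sum>k\<le>d. c' k h * \<phi> x ^ k) * inverse D)) (at x within S)"
proof -
  define N where "N y = (\<Sum>k\<le>d. c k y * \<phi> x ^ k)" for y
  define Q where "Q y = (\<Sum>k\<le>d. c k y * (\<Sum>i<k. \<phi> x ^ (k - Suc i) * \<phi> y ^ i))" for y
  have factor: "(\<phi> y - \<phi> x) * Q y = - N y" if "y \<in> S" for y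
  proof -
    have "(\<phi> y - \<phi> x) * Q y = (\<Sum>k\<le>d. c k y * (\<phi> y ^ k - \<phi> x ^ k))"
      unfolding Q_def power_diff_sumr2 by (simp add: sum_distrib_left mult_ac)
    also have "\<dots> = - N y" using root[OF that] by (simp add: N_def algebra_simps sum_subtractf)
    finally show ?thesis .
  qed
  \<comment> \<open>On the diagonal the divided difference of a power is its derivative. The
    truncated exponent at \<open>k = 0\<close> is harmless, since both sides vanish there.\<close>
  have "(\<Sum>i<k. \<phi> x ^ (k - Suc i) * \<phi> x ^ i) = of_nat k * \<phi> x ^ (k - 1)" for k
  proof -
    have "(\<Sum>i<k. \<phi> x ^ (k - Suc i) * \<phi> x ^ i) = (\<Sum>i<k. \<phi> x ^ (k - 1))"
      by (rule sum.cong) (auto simp flip: power_add)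
    then show ?thesis by simp
  qed
  then have Qx: "Q x = D" by (simp add: Q_def D)
  have "(c k \<longlongrightarrow> c k x) (at x within S)" for k
    using has_derivative_continuous[OF c] by (simp add: continuous_within)
  then have Q: "(Q \<longlongrightarrow> D) (at x within S)"
    unfolding Qx[symmetric] unfolding Q_def by (intro tendsto_intros \<phi>)
  have N: "(N has_derivative (\<lambda>h. \<Sum>k\<le>d. c' k h * \<phi> x ^ k)) (at x within S)"
    unfolding N_def by (intro has_derivative_sum has_derivative_mult_left c)
  have "N x = 0" using root \<open>x \<in> S\<close> by (simp add: N_def)
  have "((\<lambda>y. N y * inverse (Q y)) has_derivative (\<lambda>h. (\<Sum>k\<le>d. c' k h * \<phi> x ^ k) * inverse D)) (at x within S)"
    by (intro has_derivative_vanishing_times_tendsto N \<open>N x = 0\<close> tendsto_inverse Q D(2)) (simp add: Qx)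
  from has_derivative_diff[OF has_derivative_const[of "\<phi> x"] this]
  have "((\<lambda>y. \<phi> x - N y * inverse (Q y)) has_derivative (\<lambda>h. - (\<Sum>k\<le>d. c' k h * \<phi> x ^ k) * inverse D)) (at x within S)"
    by simp
  moreover have "\<forall>\<^sub>F y in at x within S. Q y \<noteq> 0"
    using Q D(2) by (rule tendsto_imp_eventually_ne)
  then have "\<forall>\<^sub>F y in at x within S. \<phi> x - N y * inverse (Q y) = \<phi> y"
    unfolding eventually_at_filter
  proof eventually_elim
    case (elim y)
    show ?case
    proof (intro impI)
      assume "y \<noteq> x" "y \<in> S"
      then have "Q y \<noteq> 0" using elim by blast
      then show "\<phi> x - N y * inverse (Q y) = \<phi> y" using factor[OF \<open>y \<in> S\<close>] by (simp add: field_simps)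
    qed
  qed
  ultimately show ?thesis
    by (rule has_derivative_transform_eventually) (simp_all add: \<open>N x = 0\<close> \<open>x \<in> S\<close>)
qed

text \<open>Simplicity is phrased as nonvanishing of the derivative of \<open>charpoly\<close>: this
  is a relatively open condition, and the same number is the denominator in the derivative of the
  eigenvalue.\<close>

definition simple_eigval_locus :: "nat \<Rightarrow> 'd::finite cmat set" where
  "simple_eigval_locus j = {A \<in> hermitian. poly (pderiv (charpoly A)) (of_real (eigval j A)) \<noteq> 0}"

lemma poly_charpoly_eigval:
  fixes A :: "'d::finite cmat"
  assumes "A \<in> hermitian" "j < CARD('d)"
  shows "poly (charpoly A) (of_real (eigval (Suc j) A)) = 0"
  unfolding charpoly_hermitian_factors[OF assms(1)] using assms(2) by (auto simp: poly_prod)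

lemma simple_eigenvalue_iff_locus:
  fixes A :: "'d::finite cmat"
  assumes "A \<in> hermitian" "j < CARD('d)"
  shows "simple_eigenvalue A (eigval (Suc j) A) \<longleftrightarrow> A \<in> simple_eigval_locus (Suc j)"
proof -
  let ?p = "charpoly A" and ?z = "complex_of_real (eigval (Suc j) A)"
  have nz: "pderiv ?p \<noteq> 0" by (simp add: pderiv_eq_0_iff charpoly_degree_lead_coeff)
  have "order ?z ?p = Suc (order ?z (pderiv ?p))"
    by (rule order_pderiv[OF charpoly_nonzero poly_charpoly_eigval[OF assms]])
  then show ?thesis using assms(1) nz
    by (simp add: simple_eigenvalue_def simple_eigval_locus_def order_root)
qed

section \<open>Differentiating a simple eigenvalue\<close>

lemma poly_charpoly_sum: "poly (charpoly A) z = (\<Sum>k\<le>CARD('d). coeff (charpoly A) k * z ^ k)"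
  for A :: "'d::finite cmat"
  by (simp add: poly_altdef charpoly_degree_lead_coeff(1))

lemma poly_pderiv_charpoly_sum:
  fixes A :: "'d::finite cmat"
  shows "poly (pderiv (charpoly A)) z = (\<Sum>k\<le>CARD('d). coeff (charpoly A) k * (of_nat k * z ^ (k - 1)))"
proof -
  have "pderiv (charpoly A) = (\<Sum>k\<le>CARD('d). monom (of_nat k * coeff (charpoly A) k) (k - 1))"
    by (subst poly_as_sum_of_monoms[of "charpoly A", symmetric])
      (simp add: charpoly_degree_lead_coeff(1) higher_pderiv_sum[of 1, simplified] pderiv_monom)
  then show ?thesis by (simp add: poly_sum poly_monom mult_ac)
qed

lemma continuous_on_pderiv_charpoly_eigval:
  assumes "j < CARD('d::finite)"
  shows "continuous_on hermitian (\<lambda>A::'d cmat. poly (pderiv (charpoly A)) (of_real (eigval (Suc j) A)))"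
  unfolding poly_pderiv_charpoly_sum
  by (intro continuous_intros continuous_on_eigval assms Ck_within_imp_continuous_on
      Ck_within_coeff_charpoly)

lemma eigval_has_derivative_formula:
  fixes A :: "'d::finite cmat"
  assumes "j < CARD('d)" "A \<in> simple_eigval_locus (Suc j)"
    and "\<And>k. ((\<lambda>A. coeff (charpoly A) k) has_derivative c' k) (at A within hermitian)"
  shows "((\<lambda>A. complex_of_real (eigval (Suc j) A)) has_derivative
      (\<lambda>Y. - (\<Sum>k\<le>CARD('d). c' k Y * of_real (eigval (Suc j) A) ^ k)
        * inverse (poly (pderiv (charpoly A)) (of_real (eigval (Suc j) A))))) (at A within hermitian)"
proof (rule has_derivative_polynomial_root[OF assms(3)])
  have "continuous_on hermitian (\<lambda>A::'d cmat. complex_of_real (eigval (Suc j) A))"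
    by (intro continuous_on_of_real continuous_on_eigval assms)
  then show "((\<lambda>A. complex_of_real (eigval (Suc j) A)) \<longlongrightarrow> of_real (eigval (Suc j) A)) (at A within hermitian)"
    using assms(2) unfolding continuous_on simple_eigval_locus_def by blast
qed (use assms(1,2) poly_charpoly_eigval in
    \<open>auto simp: poly_charpoly_sum[symmetric] simple_eigval_locus_def poly_pderiv_charpoly_sum\<close>)

text \<open>The derivative formula is built from the eigenvalue itself, the smooth coefficients of
  \<open>charpoly\<close> and a nonvanishing denominator. Thus class \<open>m\<close> for the
  eigenvalue gives class \<open>m\<close> for its derivative.\<close>

lemma Ck_within_eigval:
  assumes "j < CARD('d::finite)"
  shows "Ck_within m hermitian (simple_eigval_locus (Suc j)) (\<lambda>A::'d cmat. of_real (eigval (Suc j) A))"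
proof (induction m)
  have cont: "continuous_on (simple_eigval_locus (Suc j)) (\<lambda>A::'d cmat. complex_of_real (eigval (Suc j) A))"
    by (rule continuous_on_subset[OF continuous_on_of_real[OF continuous_on_eigval[OF assms]]])
      (auto simp: simple_eigval_locus_def)
  {
    case 0
    show ?case using cont by simp
  next
    case (Suc m)
    let ?V = "simple_eigval_locus (Suc j) :: 'd cmat set"
    have "\<forall>k. \<exists>c'. (\<forall>A\<in>?V. ((\<lambda>A. coeff (charpoly A) k) has_derivative c' A) (at A within hermitian))
        \<and> (\<forall>Y\<in>hermitian. Ck_within m hermitian ?V (\<lambda>A. c' A Y))"
      using Ck_within_coeff_charpoly[of "Suc m" hermitian ?V] by auto
    then obtain c' where
      c': "\<And>k A. A \<in> ?V \<Longrightarrow> ((\<lambda>A. coeff (charpoly A) k) has_derivative c' k A) (at A within hermitian)"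
        "\<And>k Y. Y \<in> hermitian \<Longrightarrow> Ck_within m hermitian ?V (\<lambda>A. c' k A Y)"
      by metis
    let ?f' = "\<lambda>A Y. - (\<Sum>k\<le>CARD('d). c' k A Y * of_real (eigval (Suc j) A) ^ k)
        * inverse (poly (pderiv (charpoly A)) (of_real (eigval (Suc j) A)))"
    have "Ck_within m hermitian ?V (\<lambda>A. ?f' A Y)" if "Y \<in> hermitian" for Y
    proof (intro Ck_within_mult Ck_within_minus Ck_within_inverse Ck_within_sum Ck_within_power c' that Suc)
      show "Ck_within m hermitian ?V (\<lambda>A. poly (pderiv (charpoly A)) (of_real (eigval (Suc j) A)))"
        unfolding poly_pderiv_charpoly_sum
        by (intro Ck_within_mult Ck_within_const Ck_within_sum Ck_within_power Ck_within_coeff_charpoly Suc)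
      show "\<forall>A\<in>?V. poly (pderiv (charpoly A)) (of_real (eigval (Suc j) A)) \<noteq> 0"
        by (auto simp: simple_eigval_locus_def)
    qed
    then show ?case using cont eigval_has_derivative_formula[OF assms _ c'(1)]
      by (auto intro!: exI[of _ ?f'])
  }
qed

section \<open>Gradients and tangent vectors\<close>

lemma scaleR_matrix_mult:
  fixes A B :: "'d::finite cmat"
  shows "(c *\<^sub>R A) ** B = c *\<^sub>R (A ** B)" "A ** (c *\<^sub>R B) = c *\<^sub>R (A ** B)"
  by (simp_all add: vec_eq_iff matrix_matrix_mult_def scaleR_sum_right)

lemma matrix_mult_add_diff_uminus:
  fixes A B C :: "'d::finite cmat"
  shows "(A + B) ** C = A ** C + B ** C" "A ** (B - C) = A ** B - A ** C" "(A - B) ** C = A ** C - B ** C"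
    "(- A) ** B = - (A ** B)" "A ** (- B) = - (A ** B)"
  by (simp_all add: vec_eq_iff matrix_matrix_mult_def algebra_simps sum_subtractf sum_negf sum.distrib)

lemma cadj_simps [simp]:
  fixes A B :: "'d::finite cmat"
  shows "cadj (A + B) = cadj A + cadj B" "cadj (A - B) = cadj A - cadj B" "cadj (- A) = - cadj A"
    "cadj (c *\<^sub>R A) = c *\<^sub>R cadj A" "cadj (A ** B) = cadj B ** cadj A" "cadj (cadj A) = A"
  by (simp_all add: cadj_def vec_eq_iff matrix_matrix_mult_def mult.commute)

lemma cadj_mat_of_real [simp]: "cadj (mat (complex_of_real x) :: 'd::finite cmat) = mat (of_real x)"
  by (simp add: cadj_def vec_eq_iff mat_def)

lemma hermitian_closed:
  fixes A B :: "'d::finite cmat"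
  shows "A \<in> hermitian \<Longrightarrow> B \<in> hermitian \<Longrightarrow> A + B \<in> hermitian"
    "A \<in> hermitian \<Longrightarrow> B \<in> hermitian \<Longrightarrow> A - B \<in> hermitian"
    "A \<in> hermitian \<Longrightarrow> c *\<^sub>R A \<in> hermitian"
  by (simp_all add: hermitian_def)

lemma hermitian_sum:
  fixes A :: "'i \<Rightarrow> 'd::finite cmat"
  assumes "\<And>i. i \<in> I \<Longrightarrow> A i \<in> hermitian"
  shows "(\<Sum>i\<in>I. A i) \<in> hermitian"
  using assms
proof (induction I rule: infinite_finite_induct)
  case empty
  show ?case by (simp add: hermitian_def cadj_def vec_eq_iff)
next
  case (infinite I)
  then show ?case by (simp add: hermitian_def cadj_def vec_eq_iff)
qed (auto intro: hermitian_closed)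

lemma commutator_skew_hermitian:
  "Z \<in> skew_hermitian \<Longrightarrow> A \<in> hermitian \<Longrightarrow> commutator Z A \<in> hermitian"
  by (simp add: hermitian_def skew_hermitian_def commutator_def matrix_mult_add_diff_uminus)

lemma trace_uminus: "trace (- A) = - trace A" for A :: "'d::finite cmat"
  by (simp add: trace_def sum_negf)

text \<open>Invariance of the trace form under the adjoint action, in cyclic form: any of the three
  matrices can be moved outside the bracket.\<close>

lemma trace_commutator_cyclic:
  fixes A B C :: "'d::finite cmat"
  shows "trace (A ** commutator B C) = trace (C ** commutator A B)"
proof -
  have "trace (A ** (B ** C)) = trace (C ** (A ** B))"
    by (metis matrix_mul_assoc trace_mul_sym)
  moreover have "trace (A ** (C ** B)) = trace (C ** (B ** A))"
    by (metis matrix_mul_assoc trace_mul_sym)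
  ultimately show ?thesis by (simp add: commutator_def matrix_mult_add_diff_uminus trace_sub)
qed

lemma commutator_antisym: "commutator A B = - commutator B A"
  by (simp add: commutator_def)

text \<open>The chain rule for a curve that never leaves \<open>S\<close>, so that differentiability
  of \<open>F\<close> within \<open>S\<close> suffices.\<close>

lemma has_vector_derivative_along_curve:
  assumes "(F has_derivative F') (at (\<gamma> 0) within S)" and "\<And>t. \<gamma> t \<in> S"
    and "(\<gamma> has_vector_derivative v) (at 0)"
  shows "((\<lambda>t. F (\<gamma> t)) has_vector_derivative F' v) (at 0)"
proof -
  have "(F has_derivative F') (at (\<gamma> 0) within range \<gamma>)"
    by (rule has_derivative_subset[OF assms(1)]) (use assms(2) in auto)
  then have "((\<lambda>t. F (\<gamma> t)) has_derivative (\<lambda>h. F' (h *\<^sub>R v))) (at 0)"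
    using assms(3) unfolding has_vector_derivative_def by (rule has_derivative_in_compose[rotated])
  moreover have "F' (h *\<^sub>R v) = h *\<^sub>R F' v" for h
    using has_derivative_bounded_linear[OF assms(1)] by (intro linear_scale bounded_linear.linear)
  ultimately show ?thesis by (simp add: has_vector_derivative_def)
qed

text \<open>
  The curve \<open>A + t [Z, A] + t\<^sup>2 Z (\<lambda> - A) Z = \<lambda> - (1 + t Z) (\<lambda> - A) (1 - t Z)\<close> in the Hermitian
  matrices has the eigenvalue \<open>\<lambda>\<close> at all times and velocity \<open>[Z, A]\<close> at \<open>0\<close>.
\<close>
lemma eigval_derivative_commutator:
  fixes A :: "'d::finite cmat"
  assumes "j < CARD('d)" and A: "A \<in> simple_eigval_locus (Suc j)"
  obtains L where "(eigval (Suc j) has_derivative L) (at A within hermitian)"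
    "\<And>Z. Z \<in> skew_hermitian \<Longrightarrow> L (commutator Z A) = 0"
proof -
  let ?\<mu> = "complex_of_real (eigval (Suc j) A)"
  have herm: "A \<in> hermitian" using A by (simp add: simple_eigval_locus_def)
  have "\<forall>k. \<exists>c'. ((\<lambda>A. coeff (charpoly A) k) has_derivative c') (at A within hermitian)"
    using Ck_within_coeff_charpoly[of "Suc 0" hermitian "{A}"] by auto
  then obtain c' where
    c': "\<And>k. ((\<lambda>A. coeff (charpoly A) k) has_derivative c' k) (at A within hermitian)" by metis
  let ?N' = "\<lambda>Y. \<Sum>k\<le>CARD('d). c' k Y * ?\<mu> ^ k"
  let ?L = "\<lambda>Y. Re (- ?N' Y * inverse (poly (pderiv (charpoly A)) ?\<mu>))"
  have "((\<lambda>A. Re (complex_of_real (eigval (Suc j) A))) has_derivative ?L) (at A within hermitian)"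
    by (rule has_derivative_Re[OF eigval_has_derivative_formula[OF assms c']])
  then have L: "(eigval (Suc j) has_derivative ?L) (at A within hermitian)"
    by (simp add: fun_eq_iff)
  \<comment> \<open>Here the value \<open>?\<mu>\<close> is frozen. As \<open>?L\<close> is the real
    part of a constant multiple of \<open>?N'\<close>, it is enough that \<open>?N'\<close> vanishes
    on \<open>commutator Z A\<close>.\<close>
  have N: "((\<lambda>B. poly (charpoly B) ?\<mu>) has_derivative ?N') (at A within hermitian)"
    unfolding poly_charpoly_sum by (intro has_derivative_sum has_derivative_mult_left c')
  have "?N' (commutator Z A) = 0" if Z: "Z \<in> skew_hermitian" for Z
  proof -
    let ?M = "mat ?\<mu> - A"
    define \<gamma> where "\<gamma> t = A + t *\<^sub>R commutator Z A + t\<^sup>2 *\<^sub>R (Z ** ?M ** Z)" for t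
    have "Z ** ?M ** Z \<in> hermitian"
      using Z herm by (simp add: hermitian_def skew_hermitian_def matrix_mult_add_diff_uminus matrix_mul_assoc)
    then have in_herm: "\<gamma> t \<in> hermitian" for t
      unfolding \<gamma>_def using herm commutator_skew_hermitian[OF Z herm] by (intro hermitian_closed)
    have velocity: "(\<gamma> has_vector_derivative commutator Z A) (at 0)"
      unfolding \<gamma>_def by (auto intro!: derivative_eq_intros)
    have "\<gamma> 0 = A" by (simp add: \<gamma>_def)
    then have "((\<lambda>B. poly (charpoly B) ?\<mu>) has_derivative ?N') (at (\<gamma> 0) within hermitian)"
      using N by (simp only:)
    from has_vector_derivative_along_curve[OF this in_herm velocity]
    have deriv: "((\<lambda>t. poly (charpoly (\<gamma> t)) ?\<mu>) has_vector_derivative ?N' (commutator Z A)) (at 0)" .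
    have "poly (charpoly (\<gamma> t)) ?\<mu> = 0" for t
    proof -
      have comm: "Z ** mat ?\<mu> = mat ?\<mu> ** Z"
        by (simp add: vec_eq_iff matrix_matrix_mult_def mat_def if_distrib if_distribR mult.commute cong: if_cong)
      have "mat ?\<mu> - \<gamma> t = (mat 1 + t *\<^sub>R Z) ** ?M ** (mat 1 - t *\<^sub>R Z)"
        by (simp add: \<gamma>_def commutator_def matrix_mult_add_diff_uminus matrix_add_ldistrib
            scaleR_matrix_mult comm algebra_simps power2_eq_square matrix_mul_assoc)
      moreover have "det ?M = 0" using poly_charpoly_eigval[OF herm assms(1)] by (simp add: poly_charpoly)
      ultimately show ?thesis by (simp add: poly_charpoly det_mul)
    qed
    then show ?thesis using vector_derivative_unique_at[OF deriv] by simp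
  qed
  then show ?thesis using that[OF L] by simp
qed

text \<open>Conjugating an entry of \<open>H\<close> transposes its indices, so the real trace form
  is the Euclidean inner product and gradients can be found by Euclidean duality.\<close>

lemma Re_trace_hermitian_mult:
  fixes H Y :: "'d::finite cmat"
  assumes "H \<in> hermitian"
  shows "Re (trace (H ** Y)) = H \<bullet> Y"
proof -
  have "H \<bullet> Y = (\<Sum>i\<in>UNIV. \<Sum>j\<in>UNIV. Re (cnj (H $ i $ j) * Y $ i $ j))"
    by (simp add: inner_vec_def inner_complex_def)
  also have "\<dots> = (\<Sum>i\<in>UNIV. \<Sum>j\<in>UNIV. Re (H $ j $ i * Y $ i $ j))"
    by (simp only: hermitian_nth[OF assms])
  also have "\<dots> = Re (trace (H ** Y))"
    by (subst sum.swap) (simp add: trace_def matrix_matrix_mult_def)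
  finally show ?thesis by simp
qed

text \<open>Multiplication by \<open>\<i>\<close> exchanges Hermitian and skew-Hermitian matrices,
  and turns the pairing \<open>Im (trace _)\<close> into \<open>Re (trace _)\<close>.\<close>

lemma imaginary_multiple:
  fixes A :: "'d::finite cmat"
  defines "B \<equiv> (\<chi> i j. \<i> * A $ i $ j)"
  shows "A \<in> hermitian \<Longrightarrow> B \<in> skew_hermitian" "A \<in> skew_hermitian \<Longrightarrow> B \<in> hermitian"
    "trace (B ** Y) = \<i> * trace (A ** Y)"
  by (auto simp: B_def hermitian_def skew_hermitian_def cadj_def vec_eq_iff trace_def
      matrix_matrix_mult_def sum_distrib_left mult_ac)

text \<open>Riesz representation: \<open>adjoint L 1\<close> represents \<open>L\<close> on all
  matrices, its Hermitian part \<open>H\<close> gives the same values on Hermitian matrices, and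
  \<open>\<i>\<close> times \<open>H\<close> is the required matrix.\<close>

lemma skew_hermitian_representation:
  fixes L :: "'d::finite cmat \<Rightarrow> real"
  assumes "bounded_linear L"
  obtains X where "X \<in> skew_hermitian" "\<And>Y. Y \<in> hermitian \<Longrightarrow> Im (trace (X ** Y)) = L Y"
proof -
  have lin: "linear L" using assms by (rule bounded_linear.linear)
  define B where "B = adjoint L 1"
  define H where "H = (1/2) *\<^sub>R (B + cadj B)"
  have H: "H \<in> hermitian" by (simp add: H_def hermitian_def add.commute)
  have cadj_inner: "cadj B \<bullet> Y = B \<bullet> cadj Y" for Y :: "'d cmat"
    unfolding inner_vec_def cadj_def by (subst sum.swap) (simp add: inner_complex_def)
  show ?thesis
  proof
    show "(\<chi> i j. \<i> * H $ i $ j) \<in> skew_hermitian" using H by (rule imaginary_multiple)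
    fix Y :: "'d cmat" assume Y: "Y \<in> hermitian"
    have "Im (trace ((\<chi> i j. \<i> * H $ i $ j) ** Y)) = H \<bullet> Y"
      by (simp add: imaginary_multiple Re_trace_hermitian_mult[OF H])
    also have "\<dots> = B \<bullet> Y" using Y by (simp add: H_def inner_add_left cadj_inner hermitian_def)
    also have "\<dots> = L Y" using adjoint_works[OF lin, of Y 1] by (simp add: B_def inner_commute)
    finally show "Im (trace ((\<chi> i j. \<i> * H $ i $ j) ** Y)) = L Y" .
  qed
qed

text \<open>Testing the difference \<open>D\<close> against \<open>Y\<close>, which is
  \<open>\<i>\<close> times \<open>D\<close>, gives minus the squared norm of
  \<open>Y\<close>.\<close>

lemma skew_hermitian_pairing_nondegenerate:
  fixes X :: "'d::finite cmat"
  assumes "X \<in> skew_hermitian" "X' \<in> skew_hermitian"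
    and "\<And>Y. Y \<in> hermitian \<Longrightarrow> Im (trace (X ** Y)) = Im (trace (X' ** Y))"
  shows "X = X'"
proof -
  define D where "D = X - X'"
  have "D \<in> skew_hermitian" using assms(1,2) by (simp add: D_def skew_hermitian_def)
  define Y where "Y = (\<chi> i j. \<i> * D $ i $ j)"
  have Y: "Y \<in> hermitian" unfolding Y_def by (rule imaginary_multiple) fact
  have "Im (trace (D ** Y)) = 0"
    using assms(3)[OF Y] by (simp add: D_def matrix_mult_add_diff_uminus trace_sub)
  then have "Re (trace (D ** D)) = 0"
    unfolding trace_mul_sym[of D Y] unfolding Y_def by (simp add: imaginary_multiple)
  moreover have "Y \<bullet> Y = Re (trace (Y ** Y))" by (rule Re_trace_hermitian_mult[OF Y, symmetric])
  moreover have "trace (Y ** Y) = - trace (D ** D)"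
    unfolding Y_def imaginary_multiple(3) trace_mul_sym[of D "\<chi> i j. \<i> * D $ i $ j"] by simp
  ultimately have "Y = 0" by simp
  then show ?thesis by (simp add: Y_def D_def vec_eq_iff)
qed

text \<open>This justifies the description operator in \<open>grad\<close>: existence comes from
  Riesz representation, uniqueness from nondegeneracy of the pairing.\<close>

lemma grad_representation:
  fixes e :: "nat \<Rightarrow> 'd::finite cmat"
  assumes F: "((\<lambda>X. F (e(s := X))) has_derivative F') (at (e s) within hermitian)" and "e s \<in> hermitian"
  shows "grad s F e \<in> skew_hermitian" "\<And>Y. Y \<in> hermitian \<Longrightarrow> Im (trace (grad s F e ** Y)) = F' Y"
proof -
  have deriv: "((\<lambda>t. F (e(s := e s + t *\<^sub>R Y))) has_real_derivative F' Y) (at 0)" if "Y \<in> hermitian" for Y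
    unfolding has_real_derivative_iff_has_vector_derivative
    by (rule has_vector_derivative_along_curve[where F = "\<lambda>X. F (e(s := X))" and S = hermitian])
      (use assms that in \<open>auto intro!: hermitian_closed derivative_eq_intros\<close>)
  obtain X where X: "X \<in> skew_hermitian" "\<And>Y. Y \<in> hermitian \<Longrightarrow> Im (trace (X ** Y)) = F' Y"
    using skew_hermitian_representation[OF has_derivative_bounded_linear[OF F]] by blast
  have "grad s F e = X" unfolding grad_def
  proof (rule the_equality)
    show "X \<in> skew_hermitian \<and> (\<forall>Y\<in>hermitian.
        ((\<lambda>t. F (e(s := e s + t *\<^sub>R Y))) has_real_derivative Im (trace (X ** Y))) (at 0))"
      using X deriv by simp
    fix X' assume X': "X' \<in> skew_hermitian \<and> (\<forall>Y\<in>hermitian.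
        ((\<lambda>t. F (e(s := e s + t *\<^sub>R Y))) has_real_derivative Im (trace (X' ** Y))) (at 0))"
    show "X' = X"
    proof (rule skew_hermitian_pairing_nondegenerate)
      fix Y :: "'d cmat" assume Y: "Y \<in> hermitian"
      with X' have "((\<lambda>t. F (e(s := e s + t *\<^sub>R Y))) has_real_derivative Im (trace (X' ** Y))) (at 0)" by blast
      then show "Im (trace (X' ** Y)) = Im (trace (X ** Y))"
        using DERIV_unique deriv[OF Y] X(2)[OF Y] by metis
    qed (use X X' in auto)
  qed
  then show "grad s F e \<in> skew_hermitian" "\<And>Y. Y \<in> hermitian \<Longrightarrow> Im (trace (grad s F e ** Y)) = F' Y"
    using X by auto
qed

section \<open>Curves in the orbits\<close>

lemma orbit_hermitian: "orbit \<rho> \<subseteq> hermitian"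
  by (auto simp: orbit_def outer_def hermitian_def cadj_def vec_eq_iff)

text \<open>
  The curve is \<open>\<rho> w\<^sub>t w\<^sub>t\<^sup>*\<close> with \<open>w\<^sub>t\<close> the normalization of \<open>w + t u\<close>, \<open>u = Z w\<close>. As \<open>Re (w, u) = 0\<close>, the
  normalizing factor \<open>1 + t\<^sup>2 \<bar>u\<bar>\<^sup>2\<close> does not contribute to the velocity at \<open>0\<close>.
\<close>
lemma orbit_tangent_curve:
  fixes x Z :: "'d::finite cmat"
  assumes "x \<in> orbit \<rho>" "Z \<in> skew_hermitian"
  obtains \<gamma> where "\<gamma> 0 = x" "\<And>t. \<gamma> t \<in> orbit \<rho>" "(\<gamma> has_vector_derivative commutator Z x) (at 0)"
proof -
  obtain w where w: "x = \<rho> *\<^sub>R outer w" "norm w = 1" using assms(1) by (auto simp: orbit_def)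
  define u where "u = Z *v w"
  have Z: "cnj (Z $ i $ j) = - Z $ j $ i" for i j
    using assms(2) by (auto simp: skew_hermitian_def cadj_def vec_eq_iff)
  \<comment> \<open>With \<open>u = Z w\<close>, the commutator of \<open>Z\<close> and the
    projection is this symmetrized product, because the adjoint of \<open>Z\<close> is
    \<open>- Z\<close>.\<close>
  define V where "V = (\<chi> i j. u $ i * cnj (w $ j) + w $ i * cnj (u $ j))"
  have V: "V = commutator Z (outer w)"
    by (simp add: V_def u_def vec_eq_iff commutator_def outer_def matrix_matrix_mult_def
        matrix_vector_mult_def sum_distrib_left sum_distrib_right Z sum_negf mult_ac)
  have orth: "w \<bullet> u = 0"
  proof -
    define S where "S = (\<Sum>i\<in>UNIV. \<Sum>j\<in>UNIV. cnj (w $ i) * (Z $ i $ j * w $ j))"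
    have "cnj S = (\<Sum>i\<in>UNIV. \<Sum>j\<in>UNIV. - (w $ i * (Z $ j $ i * cnj (w $ j))))" by (simp add: S_def Z)
    also have "\<dots> = - S" unfolding S_def by (subst sum.swap) (simp add: sum_negf mult_ac)
    finally have "Re (cnj S) = Re (- S)" by (rule arg_cong)
    then have "Re S = 0" by simp
    moreover have "(\<Sum>i\<in>UNIV. cnj (w $ i) * u $ i) = S"
      by (simp add: S_def u_def matrix_vector_mult_def sum_distrib_left)
    moreover have "w \<bullet> u = Re (\<Sum>i\<in>UNIV. cnj (w $ i) * u $ i)"
      by (simp add: inner_vec_def inner_complex_def)
    ultimately show ?thesis by simp
  qed
  have norm: "(norm (w + t *\<^sub>R u))\<^sup>2 = 1 + t\<^sup>2 * (norm u)\<^sup>2" for t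
    unfolding power2_norm_eq_inner using w(2) orth
    by (simp add: inner_add_left inner_add_right inner_commute power2_eq_square[of t] norm_eq_1)
  define \<gamma> where "\<gamma> t = (\<rho> / (1 + t\<^sup>2 * (norm u)\<^sup>2)) *\<^sub>R (outer w + t *\<^sub>R V + t\<^sup>2 *\<^sub>R outer u)" for t
  show ?thesis
  proof
    show "\<gamma> 0 = x" by (simp add: \<gamma>_def w)
    show "\<gamma> t \<in> orbit \<rho>" for t
    proof -
      let ?v = "w + t *\<^sub>R u"
      have pos: "1 + t\<^sup>2 * (norm u)\<^sup>2 > 0" by (simp add: add_pos_nonneg)
      then have nz: "norm ?v \<noteq> 0" using norm[of t] by (metis less_irrefl zero_power2)
      have "outer w + t *\<^sub>R V + t\<^sup>2 *\<^sub>R outer u = outer ?v"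
        by (simp add: vec_eq_iff outer_def V_def) (simp add: algebra_simps power2_eq_square scaleR_conv_of_real)
      moreover have "outer ((1 / norm ?v) *\<^sub>R ?v) = (1 / (norm ?v)\<^sup>2) *\<^sub>R outer ?v"
        by (simp add: vec_eq_iff outer_def) (simp add: scaleR_conv_of_real power2_eq_square)
      ultimately have "\<gamma> t = \<rho> *\<^sub>R outer ((1 / norm ?v) *\<^sub>R ?v)"
        by (simp add: \<gamma>_def norm[symmetric])
      moreover have "norm ((1 / norm ?v) *\<^sub>R ?v) = 1" using nz by simp
      ultimately show ?thesis unfolding orbit_def by blast
    qed
    have "((\<lambda>t. \<rho> / (1 + t\<^sup>2 * (norm u)\<^sup>2)) has_real_derivative 0) (at 0)"
      by (auto intro!: derivative_eq_intros)
    moreover have "((\<lambda>t. outer w + t *\<^sub>R V + t\<^sup>2 *\<^sub>R outer u) has_vector_derivative V) (at 0)"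
      by (auto intro!: derivative_eq_intros)
    ultimately have "(\<gamma> has_vector_derivative \<rho> *\<^sub>R V) (at 0)"
      unfolding \<gamma>_def by (rule has_vector_derivative_eq_rhs[OF has_vector_derivative_scaleR]) simp
    then show "(\<gamma> has_vector_derivative commutator Z x) (at 0)"
      by (simp add: w V commutator_def scaleR_matrix_mult scaleR_diff_right)
  qed
qed

section \<open>The Poisson bracket\<close>

lemma Ck_on_const: "Ck_on n k U (\<lambda>_. c)"
proof (induction k arbitrary: c)
  case (Suc k)
  then show ?case by (auto intro!: exI[of _ "\<lambda>_ _ _. 0"])
qed auto

lemma continuous_on_partial_sum: "continuous_on U (partial_sum i)"
  unfolding partial_sum_def
  by (intro continuous_on_sum continuous_on_subset[OF continuous_on_product_coordinates]) auto

lemma partial_sum_fun_upd: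
  fixes e :: "nat \<Rightarrow> 'd::finite cmat"
  shows "s \<in> {1..i + 1} \<Longrightarrow> partial_sum i (e(s := X)) = partial_sum i e - e s + X"
    "s \<notin> {1..i + 1} \<Longrightarrow> partial_sum i (e(s := X)) = partial_sum i e"
proof -
  assume "s \<in> {1..i + 1}"
  then show "partial_sum i (e(s := X)) = partial_sum i e - e s + X"
    unfolding partial_sum_def by (subst (1 2) sum.remove[of _ s]) (auto intro!: sum.cong)
next
  assume "s \<notin> {1..i + 1}"
  then show "partial_sum i (e(s := X)) = partial_sum i e"
    unfolding partial_sum_def by (intro sum.cong) auto
qed

lemma partial_sum_hermitian:
  "e \<in> herm_tuples n \<Longrightarrow> i + 1 \<le> n \<Longrightarrow> partial_sum i e \<in> hermitian"
  unfolding partial_sum_def herm_tuples_def by (intro hermitian_sum) (auto simp: PiE_iff)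

text \<open>As a function of \<open>e s\<close>, the partial sum is a translation by a Hermitian
  matrix for \<open>s \<le> i + 1\<close> and constant otherwise. Hence the derivative is the same
  in all slots that occur.\<close>

lemma has_derivative_partial_sum:
  fixes f :: "'d::finite cmat \<Rightarrow> 'b::real_normed_vector"
  assumes f: "(f has_derivative f') (at (partial_sum i e) within hermitian)"
    and "e \<in> herm_tuples n" "i + 1 \<le> n" "s \<in> {1..n}"
  shows "((\<lambda>X. f (partial_sum i (e(s := X)))) has_derivative
      (\<lambda>Y. if s \<le> i + 1 then f' Y else 0)) (at (e s) within hermitian)"
proof (cases "s \<le> i + 1")
  case True
  then have s: "s \<in> {1..i + 1}" using assms(4) by simp
  have "e s \<in> hermitian" using assms(2,4) by (auto simp: herm_tuples_def)
  let ?h = "\<lambda>X. partial_sum i e - e s + X"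
  have "?h ` hermitian \<subseteq> hermitian"
    using partial_sum_hermitian[OF assms(2,3)] \<open>e s \<in> hermitian\<close> by (auto intro: hermitian_closed)
  then have "(f has_derivative f') (at (?h (e s)) within ?h ` hermitian)"
    using f by (auto intro: has_derivative_subset)
  moreover have "(?h has_derivative (\<lambda>Y. Y)) (at (e s) within hermitian)"
    by (auto intro!: derivative_eq_intros)
  ultimately have "((\<lambda>X. f (?h X)) has_derivative f') (at (e s) within hermitian)"
    by (rule has_derivative_in_compose[rotated])
  then show ?thesis using True by (simp add: partial_sum_fun_upd(1)[OF s])
next
  case False
  then have "s \<notin> {1..i + 1}" by simp
  then show ?thesis using False by (simp add: partial_sum_fun_upd(2))
qed

text \<open>Each partial derivative is either zero or again a function of the partial sum, built
  from \<open>f'\<close>; this closes the induction.\<close>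

lemma Ck_on_partial_sum:
  assumes "Ck_within k hermitian V f" and "U \<subseteq> herm_tuples n" "i + 1 \<le> n"
    and V: "\<And>e. e \<in> U \<Longrightarrow> partial_sum i e \<in> V"
  shows "Ck_on n k U (\<lambda>e. Re (f (partial_sum i e)))"
  using assms(1)
proof (induction k arbitrary: f)
  have cont: "continuous_on U (\<lambda>e. Re (f (partial_sum i e)))" if "continuous_on V f" for f
    by (intro continuous_on_Re continuous_on_compose2[OF that] continuous_on_partial_sum) (use V in auto)
  {
    case 0
    then show ?case using cont by simp
  next
    case (Suc k)
    then obtain f' where f': "\<forall>A\<in>V. (f has_derivative f' A) (at A within hermitian)"
      "\<forall>Y\<in>hermitian. Ck_within k hermitian V (\<lambda>A. f' A Y)" by auto
    let ?F' = "\<lambda>s e Y. if s \<le> i + 1 then Re (f' (partial_sum i e) Y) else 0"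
    have "((\<lambda>X. Re (f (partial_sum i (e(s := X))))) has_derivative ?F' s e) (at (e s) within hermitian)"
      if "s \<in> {1..n}" "e \<in> U" for s e
    proof (rule has_derivative_partial_sum[where f = "\<lambda>A. Re (f A)"])
      show "((\<lambda>A. Re (f A)) has_derivative (\<lambda>Y. Re (f' (partial_sum i e) Y))) (at (partial_sum i e) within hermitian)"
        using f'(1) V[OF that(2)] by (intro has_derivative_Re) auto
    qed (use that assms in auto)
    moreover have "Ck_on n k U (\<lambda>e. ?F' s e Y)" if "Y \<in> hermitian" for s Y
      using Suc.IH f'(2) that by (cases "s \<le> i + 1") (auto simp: Ck_on_const)
    moreover have "continuous_on U (\<lambda>e. Re (f (partial_sum i e)))" using Suc.prems cont by auto
    ultimately show ?case by (auto intro!: exI[of _ ?F'])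
  }
qed

lemma orbit_product_subset_herm_tuples: "orbit_product n r \<subseteq> herm_tuples n"
  unfolding orbit_product_def herm_tuples_def by (intro PiE_mono orbit_hermitian)

lemma openin_simple_partial_sum:
  assumes "j < CARD('d::finite)" "i + 1 \<le> n"
  shows "openin (top_of_set (herm_tuples n))
    {e \<in> herm_tuples n. partial_sum i e \<in> (simple_eigval_locus (Suc j) :: 'd cmat set)}"
proof -
  let ?D = "\<lambda>A::'d cmat. poly (pderiv (charpoly A)) (of_real (eigval (Suc j) A))"
  have "continuous_on (herm_tuples n) (\<lambda>e. ?D (partial_sum i e))"
    by (rule continuous_on_compose2[OF continuous_on_pderiv_charpoly_eigval[OF assms(1)] continuous_on_partial_sum])
      (use partial_sum_hermitian assms(2) in blast)
  then have "openin (top_of_set (herm_tuples n)) (herm_tuples n \<inter> (\<lambda>e. ?D (partial_sum i e)) -` (- {0}))"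
    by (rule continuous_openin_preimage_gen) auto
  also have "herm_tuples n \<inter> (\<lambda>e. ?D (partial_sum i e)) -` (- {0})
      = {e \<in> herm_tuples n. partial_sum i e \<in> simple_eigval_locus (Suc j)}"
    using partial_sum_hermitian[OF _ assms(2)] by (auto simp: simple_eigval_locus_def)
  finally show ?thesis .
qed

lemma simple_eigenvalue_lam_iff:
  assumes "j < CARD('d::finite)" "i + 1 \<le> n" "e \<in> (herm_tuples n :: (nat \<Rightarrow> 'd cmat) set)"
  shows "simple_eigenvalue (partial_sum i e) (lam i (Suc j) e) \<longleftrightarrow> partial_sum i e \<in> simple_eigval_locus (Suc j)"
  unfolding lam_def by (rule simple_eigenvalue_iff_locus[OF partial_sum_hermitian[OF assms(3,2)] assms(1)])

lemma openin_simple_locus: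
  assumes "j < CARD('d::finite)" "l < CARD('d)" "i + 1 \<le> n" "k + 1 \<le> n"
  shows "openin (top_of_set (orbit_product n r :: (nat \<Rightarrow> 'd cmat) set)) (simple_locus n r i (Suc j) k (Suc l))"
proof -
  let ?U = "\<lambda>i j. {e \<in> herm_tuples n. partial_sum i e \<in> (simple_eigval_locus (Suc j) :: 'd cmat set)}"
  have "openin (top_of_set (herm_tuples n)) (?U i j \<inter> ?U k l)"
    by (intro openin_Int openin_simple_partial_sum assms)
  then obtain T where "open T" "?U i j \<inter> ?U k l = herm_tuples n \<inter> T" by (auto simp: openin_open)
  then have "openin (top_of_set (orbit_product n r)) (orbit_product n r \<inter> (?U i j \<inter> ?U k l))"
    using orbit_product_subset_herm_tuples[of n r] by (auto simp: openin_open)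
  also have "orbit_product n r \<inter> (?U i j \<inter> ?U k l) = simple_locus n r i (Suc j) k (Suc l)"
    using orbit_product_subset_herm_tuples[of n r] assms
    by (auto simp: simple_locus_def simple_eigenvalue_lam_iff)
  finally show ?thesis .
qed

text \<open>\<open>lam\<close> is defined on all Hermitian tuples and smooth wherever the eigenvalue
  is simple, so it serves as its own extension. This provides the existence part of
  \<open>has_poisson_bracket\<close>.\<close>

lemma local_smooth_extension_lam:
  assumes "j < CARD('d::finite)" "i + 1 \<le> n" "e \<in> (herm_tuples n :: (nat \<Rightarrow> 'd cmat) set)"
    and "partial_sum i e \<in> simple_eigval_locus (Suc j)"
  shows "local_smooth_extension n r (lam i (Suc j)) e (lam i (Suc j))"
proof -
  let ?U = "{e \<in> herm_tuples n. partial_sum i e \<in> (simple_eigval_locus (Suc j) :: 'd cmat set)}"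
  have "Ck_on n k ?U (\<lambda>e. Re (of_real (eigval (Suc j) (partial_sum i e))))" for k
    by (rule Ck_on_partial_sum[OF Ck_within_eigval[OF assms(1)]]) (use assms(2) in auto)
  then have "smooth_fun_on n ?U (lam i (Suc j))" by (simp add: smooth_fun_on_def lam_def[abs_def])
  then show ?thesis unfolding local_smooth_extension_def
    using openin_simple_partial_sum[OF assms(1,2)] assms(3,4) by (intro exI[of _ ?U]) auto
qed

text \<open>Both derivatives can be computed along a curve in the \<open>s\<close>-th orbit with
  velocity \<open>commutator Z (e s)\<close>, on which \<open>F\<close> and \<open>G\<close> agree
  for small times.\<close>

lemma tangential_derivative_unique:
  fixes e :: "nat \<Rightarrow> 'd::finite cmat"
  assumes U: "openin (top_of_set (herm_tuples n)) U" "e \<in> U" and e: "e \<in> orbit_product n r"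
    and eq: "\<And>x. x \<in> U \<inter> orbit_product n r \<Longrightarrow> F x = G x" and s: "s \<in> {1..n}"
    and F: "((\<lambda>X. F (e(s := X))) has_derivative F') (at (e s) within hermitian)"
    and G: "((\<lambda>X. G (e(s := X))) has_derivative G') (at (e s) within hermitian)"
    and Z: "Z \<in> skew_hermitian"
  shows "F' (commutator Z (e s)) = (G' (commutator Z (e s)) :: real)"
proof -
  have "e s \<in> orbit (r s)" using e s by (auto simp: orbit_product_def)
  then obtain \<gamma> where \<gamma>: "\<gamma> 0 = e s" "\<And>t. \<gamma> t \<in> orbit (r s)"
      "(\<gamma> has_vector_derivative commutator Z (e s)) (at 0)"
    using orbit_tangent_curve Z by blast
  have herm: "\<gamma> t \<in> hermitian" for t using \<gamma>(2) orbit_hermitian by blast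
  have orb: "e(s := \<gamma> t) \<in> orbit_product n r" for t
    using e s \<gamma>(2) by (auto simp: orbit_product_def PiE_iff extensional_def)
  obtain T where T: "open T" "U = herm_tuples n \<inter> T" using U(1) by (auto simp: openin_open)
  \<comment> \<open>Continuity of the coordinate update in the product topology keeps the updated
    tuple inside \<open>U\<close> for small times.\<close>
  have "continuous_on UNIV (\<lambda>X. e(s := X))"
  proof (rule continuous_on_coordinatewise_then_product)
    show "continuous_on UNIV (\<lambda>X. (e(s := X)) a)" for a
      by (cases "a = s") (auto simp: fun_upd_def intro: continuous_on_id)
  qed
  then have op: "open ((\<lambda>X. e(s := X)) -` T)" using T(1) by (auto intro: open_vimage)
  have "continuous (at 0) \<gamma>" using \<gamma>(3) by (rule has_vector_derivative_continuous)
  then have "(\<gamma> \<longlongrightarrow> e s) (at 0)" by (simp add: continuous_at \<gamma>(1))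
  moreover note op
  moreover have "e s \<in> (\<lambda>X. e(s := X)) -` T" using U(2) T(2) by simp
  ultimately have "\<forall>\<^sub>F t in at 0. \<gamma> t \<in> (\<lambda>X. e(s := X)) -` T"
    by (rule topological_tendstoD)
  then have "\<forall>\<^sub>F t in at 0. F (e(s := \<gamma> t)) = G (e(s := \<gamma> t))"
  proof eventually_elim
    case (elim t)
    then show ?case using eq orb[of t] T(2) orbit_product_subset_herm_tuples by blast
  qed
  moreover have "F (e(s := \<gamma> 0)) = G (e(s := \<gamma> 0))" using eq U(2) e \<gamma>(1) by simp
  ultimately have agree: "\<forall>\<^sub>F t in nhds 0. F (e(s := \<gamma> t)) = G (e(s := \<gamma> t))"
    by (simp add: eventually_nhds_conv_at)
  have "((\<lambda>t. F (e(s := \<gamma> t))) has_real_derivative F' (commutator Z (e s))) (at 0)"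
    unfolding has_real_derivative_iff_has_vector_derivative
    using F by (intro has_vector_derivative_along_curve[where F = "\<lambda>X. F (e(s := X))" and S = hermitian] \<gamma>(3)) (simp_all add: \<gamma>(1) herm)
  then have "((\<lambda>t. G (e(s := \<gamma> t))) has_real_derivative F' (commutator Z (e s))) (at 0)"
    using DERIV_cong_ev[OF refl agree refl] by blast
  moreover have "((\<lambda>t. G (e(s := \<gamma> t))) has_real_derivative G' (commutator Z (e s))) (at 0)"
    unfolding has_real_derivative_iff_has_vector_derivative
    using G by (intro has_vector_derivative_along_curve[where F = "\<lambda>X. G (e(s := X))" and S = hermitian] \<gamma>(3)) (simp_all add: \<gamma>(1) herm)
  ultimately show ?thesis by (rule DERIV_unique)
qed

text \<open>Paired with a tangent vector of the orbit, the gradient of any extension gives what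
  \<open>lam\<close> itself gives, namely \<open>L\<close> in the slots of the partial sum and zero
  elsewhere.\<close>

lemma grad_extension_lam:
  fixes e :: "nat \<Rightarrow> 'd::finite cmat"
  assumes ext: "local_smooth_extension n r (lam i j) e F" and e: "e \<in> orbit_product n r"
    and i: "i + 1 \<le> n" and s: "s \<in> {1..n}"
    and L: "(eigval j has_derivative L) (at (partial_sum i e) within hermitian)"
  shows "grad s F e \<in> skew_hermitian"
    and "\<And>Z. Z \<in> skew_hermitian \<Longrightarrow> Im (trace (grad s F e ** commutator Z (e s)))
      = (if s \<le> i + 1 then L (commutator Z (e s)) else 0)"
proof -
  obtain U where U: "openin (top_of_set (herm_tuples n)) U" "e \<in> U" "smooth_fun_on n U F"
    "\<And>x. x \<in> U \<inter> orbit_product n r \<Longrightarrow> F x = lam i j x"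
    using ext by (auto simp: local_smooth_extension_def)
  have "Ck_on n (Suc 0) U F" using U(3) unfolding smooth_fun_on_def by blast
  then obtain F'' where "\<forall>s\<in>{1..n}. \<forall>e\<in>U.
      ((\<lambda>X. F (e(s := X))) has_derivative F'' s e) (at (e s) within hermitian)" by auto
  then obtain F' where F': "((\<lambda>X. F (e(s := X))) has_derivative F') (at (e s) within hermitian)"
    using U(2) s by blast
  have tuple: "e \<in> herm_tuples n" using e orbit_product_subset_herm_tuples by blast
  then have es: "e s \<in> hermitian" using s by (auto simp: herm_tuples_def)
  show "grad s F e \<in> skew_hermitian" by (rule grad_representation(1)[OF F' es])
  fix Z :: "'d cmat" assume Z: "Z \<in> skew_hermitian"
  have "((\<lambda>X. lam i j (e(s := X))) has_derivative (\<lambda>Y. if s \<le> i + 1 then L Y else 0)) (at (e s) within hermitian)"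
    unfolding lam_def by (rule has_derivative_partial_sum[OF L tuple i s])
  from tangential_derivative_unique[OF U(1,2) e U(4) s F' this Z]
  show "Im (trace (grad s F e ** commutator Z (e s))) = (if s \<le> i + 1 then L (commutator Z (e s)) else 0)"
    using grad_representation(2)[OF F' es commutator_skew_hermitian[OF Z es]] by simp
qed

section \<open>Vanishing of the bracket\<close>

lemma commutator_sum: "commutator Z (\<Sum>s\<in>I. e s) = (\<Sum>s\<in>I. commutator Z (e s))"
  for Z :: "'d::finite cmat"
  by (induction I rule: infinite_finite_induct)
    (simp_all add: commutator_def matrix_mult_add_diff_uminus matrix_add_ldistrib)

lemma lie_poisson_lam_zero_le:
  fixes e :: "nat \<Rightarrow> 'd::finite cmat"
  assumes "j < CARD('d)" "l < CARD('d)" "i \<le> k" "k + 1 \<le> n" and e: "e \<in> orbit_product n r"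
    and simple: "partial_sum i e \<in> simple_eigval_locus (Suc j)" "partial_sum k e \<in> simple_eigval_locus (Suc l)"
    and F: "local_smooth_extension n r (lam i (Suc j)) e F"
    and G: "local_smooth_extension n r (lam k (Suc l)) e G"
  shows "lie_poisson n F G e = 0"
proof -
  obtain L where L: "(eigval (Suc j) has_derivative L) (at (partial_sum i e) within hermitian)"
    "\<And>Z. Z \<in> skew_hermitian \<Longrightarrow> L (commutator Z (partial_sum i e)) = 0"
    using eigval_derivative_commutator[OF assms(1) simple(1)] by blast
  obtain M where M: "(eigval (Suc l) has_derivative M) (at (partial_sum k e) within hermitian)"
    using eigval_derivative_commutator[OF assms(2) simple(2)] by blast
  \<comment> \<open>One matrix \<open>H\<close> represents \<open>M\<close> for every slot
    \<open>s\<close>; its independence of \<open>s\<close> allows the final sum to be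
    collected.\<close>
  obtain H where H: "H \<in> skew_hermitian" "\<And>Y. Y \<in> hermitian \<Longrightarrow> Im (trace (H ** Y)) = M Y"
    using skew_hermitian_representation[OF has_derivative_bounded_linear[OF M]] by blast
  have i: "i + 1 \<le> n" using assms by simp
  have "Im (trace (e s ** commutator (grad s F e) (grad s G e)))
      = (if s \<le> i + 1 then L (commutator H (e s)) else 0)" if s: "s \<in> {1..n}" for s
  proof -
    let ?X = "grad s F e" and ?Y = "grad s G e"
    have es: "e s \<in> hermitian"
      using e s orbit_product_subset_herm_tuples by (fastforce simp: herm_tuples_def)
    note X = grad_extension_lam[OF F e i s L(1)] and Y = grad_extension_lam[OF G e assms(4) s M]
    have "trace (e s ** commutator ?X ?Y) = - trace (?Y ** commutator ?X (e s))"
      by (simp add: trace_commutator_cyclic[of "e s"] commutator_antisym[of "e s"] matrix_mult_add_diff_uminus trace_uminus)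
    then have "Im (trace (e s ** commutator ?X ?Y)) = - (if s \<le> k + 1 then M (commutator ?X (e s)) else 0)"
      using Y(2)[OF X(1)] by simp
    \<comment> \<open>Expressing \<open>M\<close> through \<open>H\<close> and using cyclicity moves
      \<open>?X\<close> outside, where it pairs with the tangent vector
      \<open>commutator H (e s)\<close> and can in turn be replaced by \<open>L\<close>.\<close>
    also have "M (commutator ?X (e s)) = Im (trace (H ** commutator ?X (e s)))"
      using H(2)[OF commutator_skew_hermitian[OF X(1) es]] by simp
    also have "trace (H ** commutator ?X (e s)) = trace (?X ** commutator (e s) H)"
      by (metis trace_commutator_cyclic)
    also have "\<dots> = - trace (?X ** commutator H (e s))"
      by (simp add: commutator_antisym[of "e s"] matrix_mult_add_diff_uminus trace_uminus)
    \<comment> \<open>The two signs cancel. For \<open>i + 1 < s \<le> k + 1\<close> the pairing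
      with \<open>?X\<close> is zero, and beyond \<open>k + 1\<close> both sides vanish;
      \<open>i \<le> k\<close> leaves no other case outside the slots of
      \<open>partial_sum i\<close>.\<close>
    finally show ?thesis using X(2)[OF H(1)] \<open>i \<le> k\<close> by (auto split: if_splits)
  qed
  then have "lie_poisson n F G e = (\<Sum>s=1..n. if s \<le> i + 1 then L (commutator H (e s)) else 0)"
    unfolding lie_poisson_def by (intro sum.cong) auto
  also have "\<dots> = (\<Sum>s=1..i + 1. L (commutator H (e s)))"
    by (rule sum.mono_neutral_cong_right) (use i in auto)
  also have "\<dots> = L (commutator H (partial_sum i e))"
    unfolding partial_sum_def commutator_sum
    by (rule linear_sum[symmetric]) (rule bounded_linear.linear[OF has_derivative_bounded_linear[OF L(1)]])
  also have "\<dots> = 0" by (rule L(2)[OF H(1)])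
  finally show ?thesis .
qed

lemma lie_poisson_antisym: "lie_poisson n F G e = - lie_poisson n G F e"
  unfolding lie_poisson_def sum_negf[symmetric]
proof (intro sum.cong refl)
  show "Im (trace (e s ** commutator (grad s F e) (grad s G e)))
      = - Im (trace (e s ** commutator (grad s G e) (grad s F e)))" for s
    by (simp add: commutator_antisym[of "grad s F e"] matrix_mult_add_diff_uminus trace_uminus)
qed

theorem proposition5p2p1:
  fixes m n :: nat and r :: "nat \<Rightarrow> real" and i j k l :: nat
  assumes "m \<ge> 1" and "n \<ge> 4"
    and "CARD('d::finite) = m + 1"
    and "\<forall>s\<in>{1..n}. r s > 0"
    and "i \<in> {1..n - 3}" and "k \<in> {1..n - 3}"
    and "j \<in> {1..m + 1}" and "l \<in> {1..m + 1}"
  shows "openin (top_of_set (orbit_product n r :: (nat \<Rightarrow> 'd cmat) set)) (simple_locus n r i j k l)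
    \<and> (\<forall>e \<in> (simple_locus n r i j k l :: (nat \<Rightarrow> 'd cmat) set).
          has_poisson_bracket n r (lam i j) (lam k l) e 0)"
proof -
  \<comment> \<open>Eigenvalues are numbered from 1, whereas the lemmas use indices below
    \<open>CARD('d)\<close>.\<close>
  obtain j' l' where jl: "j = Suc j'" "l = Suc l'" using assms(7,8) by (cases j; cases l) auto
  have j': "j' < CARD('d)" and l': "l' < CARD('d)" using assms jl by auto
  have i: "i + 1 \<le> n" and k: "k + 1 \<le> n" using assms by auto
  have "has_poisson_bracket n r (lam i j) (lam k l) e 0"
    if "e \<in> simple_locus n r i j k l" for e :: "nat \<Rightarrow> 'd cmat"
  proof -
    have e: "e \<in> orbit_product n r" using that by (simp add: simple_locus_def)
    then have tuple: "e \<in> herm_tuples n" using orbit_product_subset_herm_tuples by blast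
    have simple: "partial_sum i e \<in> simple_eigval_locus (Suc j')" "partial_sum k e \<in> simple_eigval_locus (Suc l')"
      using that simple_eigenvalue_lam_iff[OF j' i tuple] simple_eigenvalue_lam_iff[OF l' k tuple]
      by (auto simp: simple_locus_def jl)
    have "lie_poisson n F G e = 0"
      if F: "local_smooth_extension n r (lam i j) e F" and G: "local_smooth_extension n r (lam k l) e G" for F G
    \<comment> \<open>The case \<open>k < i\<close> follows from antisymmetry after exchanging the
      two functions.\<close>
    proof (cases "i \<le> k")
      case True
      show ?thesis by (rule lie_poisson_lam_zero_le[OF j' l' True k e simple F[unfolded jl] G[unfolded jl]])
    next
      case False
      then have "lie_poisson n G F e = 0"
        by (intro lie_poisson_lam_zero_le[OF l' j' _ i e simple(2,1) G[unfolded jl] F[unfolded jl]]) simp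
      then show ?thesis by (simp add: lie_poisson_antisym[of n F])
    qed
    then show ?thesis unfolding has_poisson_bracket_def
      using local_smooth_extension_lam[OF j' i tuple simple(1)] local_smooth_extension_lam[OF l' k tuple simple(2)]
      unfolding jl by blast
  qed
  then show ?thesis using openin_simple_locus[OF j' l' i k] by (auto simp: jl)
qed

end
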